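(* Let $\gamma_+>1$, $\gamma_->2$, and let $(\mu,U)$ be a $(\gamma_+,\gamma_-)$-admissible global solution, defined for $s\ge-\delta_0$, to the geometric reduced system of the quasilinear wave system (QW) in the context. Fix a sufficiently small $\delta\in(0,\delta_0)$, $N\ge2$, $\gamma_1\in(2,\min\{4,2(\gamma_--1)\})$. For all sufficiently small $\varepsilon>0$ let $u$ be the global $C^N$ solution to (QW) for $t\ge0$ matching $(\mu,U)$ at infinite time of size $\varepsilon$ (see context). (a) Suppose there exist $(s^0,q^0,\omega^0)\in(1,\infty)\times\mathbb{R}\times\mathbb{S}^2$ and constants $c_1,C_1>0$ such that $|U(s,q^0,\omega^0)|+|\mu U_q(s,q^0,\omega^0)|\ge c_1e^{-C_1s}$ for all $s>s^0$. Then for $\varepsilon\ll1$ we have $u\not\equiv0$. (b) Suppose there exist $\kappa\ge0$, $M>0$, $C_1>0$ and $(s^0,q^0,\omega^0)\in(1,\infty)\times\mathbb{R}\times\mathbb{S}^2$ such that $|U(s,q,\omega^0)|\ge M\langle q\rangle^{-\kappa}e^{-C_1s}$ for all $s>s^0$, $q>q^0$. Then for each $\lambda\in(0,\frac1{2\kappa+1})$ and $\varepsilon\ll_{\kappa,\lambda,q^0,M}1$, $$|u(t,r\omega^0)|\gtrsim_\kappa M\varepsilon t^{-1-C_\kappa\varepsilon}\langle r-t\rangle^{-\kappa}$$ for all $t\ge e^{(s^0+\delta)/\varepsilon}$ and $r>0$ such that $|r-t|<t^\lambda$ and $q(t,r\omega^0)>q^0$. Consequently $\mathrm{supp}\,(u,u_t)|_{t=0}$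 is not compact. (c) Suppose there exist $\kappa\ge1$, $M>0$, $C_1>0$ and $(s^0,q^0,\omega^0)\in(1,\infty)\times\mathbb{R}\times\mathbb{S}^2$ such that $|\mu U_q(s,q,\omega^0)|\ge M\langle q\rangle^{-\kappa}e^{-C_1s}$ for all $s>s^0$, $q>q^0$. Then for each $\lambda\in(0,\frac1{2\kappa-1})$ and $\varepsilon\ll_{\kappa,\lambda,q^0,M}1$, $$|(u_t-u_r)(t,r\omega^0)|\gtrsim_\kappa M\varepsilon t^{-1-C_\kappa\varepsilon}\langle r-t\rangle^{-\kappa}$$ for all $t\ge e^{(s^0+\delta)/\varepsilon}$ and $r>0$ such that $|r-t|<t^\lambda$ and $q(t,r\omega^0)>q^0$. Consequently $\mathrm{supp}\,(u,u_t)|_{t=0}$ is not compact. The smallness threshold for $\varepsilon$ may depend on $(\mu,U)$ and $M$, but the constants in the displayed lower bounds do not depend on $M$ or $\varepsilon$.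
   Context: Notation: $\partial_0=\partial_t$; repeated indices summed (Greek over $0,\dots,3$; $I,J,K$ over $1,\dots,M_0$). $r=|x|$, $\omega=x/r$, $\partial_r=\sum_i\omega_i\partial_i$, $\widehat\omega=(-1,\omega)$, $\langle z\rangle=\sqrt{1+|z|^2}$. $Z$ denotes any of $\partial_\alpha$, $t\partial_t+r\partial_r$, $x_i\partial_j-x_j\partial_i$, $x_i\partial_t+t\partial_i$; $Z^I$ is a product of $|I|$ of them. $\partial_\omega$ are the derivatives $\partial_{x_i}$ of the degree-zero homogeneous extension, restricted to $\mathbb{S}^2$. (QW): $g^{\alpha\beta}(u,\partial u)\partial_\alpha\partial_\beta u^{(I)}=f^{(I)}(u,\partial u)$, $I=1,\dots,M_0$, for $u:\mathbb{R}^{1+3}\to\mathbb{R}^{M_0}$, with $g^{\alpha\beta}=g^{\beta\alpha}$, $f^{(I)}$ smooth, and near $0$: $g^{\alpha\beta}=m^{\alpha\beta}+g^{\alpha\beta}_Ju^{(J)}+g_J^{\alpha\beta\lambda}\partial_\lambda u^{(J)}+O(|u|^2+|\partial u|^2)$, $(m^{\alpha\beta})=\mathrm{diag}(-1,1,1,1)$, $f^{(I)}=f^{I,\alpha\beta}_{JK}\partial_\alpha u^{(J)}\partial_\beta u^{(K)}+O(|u|^4+|\partial u|(|\partial u|^2+|u|^2))$. With $G_{2,J}=g_J^{\alpha\beta}\widehat\omega_\alpha\widehat\omega_\beta$, $G_{3,J}=g_J^{\alpha\beta\lambda}\widehat\omega_\alpha\widehat\omega_\beta\widehat\omega_\lambda$,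 $F^I_{2,JK}=f^{I,\alpha\beta}_{JK}\widehat\omega_\alpha\widehat\omega_\beta$, the geometric reduced system for $(\mu,(U^{(I)}))(s,q,\omega)$ is $\partial_s(\mu U_q^{(I)})=-\frac14F^I_{2,JK}\mu^2U_q^{(J)}U_q^{(K)}$, $\partial_s\mu=\frac14G_{2,J}\mu^2U_q^{(J)}-\frac18G_{3,J}\mu^2\partial_q(\mu U_q^{(J)})$. Admissibility: let $\gamma_{\mathrm{sgn}(q)}=\gamma_+$ if $q\ge0$, $=\gamma_-$ if $q<0$. A smooth solution on $[-\delta_0,\infty)\times\mathbb{R}\times\mathbb{S}^2$ ($0<\delta_0<1$) is $(\gamma_+,\gamma_-)$-admissible if: $-Ce^{Cs}\le\mu\le-C^{-1}e^{-Cs}$; $|\mu_q|\lesssim\langle q\rangle^{-1-\gamma_{\mathrm{sgn}(q)}}|s\mu|$; $|\mu U_q|\lesssim1$; $\sum_{J,K}|G_{3,J}\mu\partial_q(\mu U_q^{(K)})|\lesssim1$; $\sum_{J,K}|G_{2,J}\partial_q(\mu U_q^{(K)})|\lesssim\langle q\rangle^{-\gamma_{\mathrm{sgn}(q)}}$; and for all $a,b,c\ge0$: $|\partial_s^a\partial_q^b\partial_\omega^c(\mu+2)|\lesssim e^{C_{a,b,c}s}\langle q\rangle^{-b-\gamma_{\mathrm{sgn}(q)}}$, $|\partial_s^a\partial_\omega^cU|\lesssim e^{C_{a,c}s}\langle\max\{0,-q\}\rangle^{1-\gamma_-}$, $|\partial_s^a\partial_q^b\partial_\omega^cU_q|\lesssim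 e^{C_{a,b,c}s}\langle q\rangle^{-b-\gamma_{\mathrm{sgn}(q)}}$. For small $\varepsilon$, on $\{t\ge1/\varepsilon,|x|\ge t/2\}$, $q(t,x)$ solves $(\partial_t-\partial_r)q=\mu(\varepsilon\ln t-\delta,q(t,x),\omega)$, $q=-|x|$ when $t=2|x|$; functions of $(s,q,\omega)$ become functions of $(t,x)$ via $(s,q,\omega)=(\varepsilon\ln t-\delta,q(t,x),\omega)$. Matching: with $w_0=1_{r\ge t}+\langle r-t\rangle^{\gamma_1}1_{r<t}$, "$u$ matches $(\mu,U)$ at infinite time of size $\varepsilon$" means, with constants independent of $\varepsilon$, for all $|I|\le N-1$: (i) $\|w_0^{1/2}\partial Z^I(u-\varepsilon r^{-1}U)(t)\|_{L^2(|x|/t\in[1/2,3/2])}+\|w_0^{1/2}\partial Z^Iu(t)\|_{L^2(|x|/t\notin[1/2,3/2])}\lesssim\varepsilon t^{-1/2+C\varepsilon}$ for $t\ge1/\varepsilon$, and $\|w_0^{1/2}\partial Z^Iu(t)\|_{L^2(\mathbb{R}^3)}\lesssim\varepsilon$ for $0\le t\le1/\varepsilon$; (ii) for $t\ge1/\varepsilon$: $|\partial Z^I(u-\varepsilon r^{-1}U)|1_{r/t\in[1/2,3/2]}+|\partial Z^Iu|1_{r/t\notin[1/2,3/2]}\lesssim\varepsilon t^{-1/2+C\varepsilon}\langle t+r\rangle^{-1}\langle t-r\rangle^{-1/2}w_0^{-1/2}$; $|Z^I(u-\varepsilon r^{-1}U)|1_{r/t\in[1/2,3/2]}+|Z^Iu|1_{r/t\notin[1/2,3/2]}\lesssim\varepsilon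 t^{-1/2+C\varepsilon}(t^{-1}\langle r-t\rangle^{-(\gamma_1-1)/2}1_{r<t}+t^{-1}\langle r-t\rangle^{1/2}1_{t\le r\le2t}+r^{-1/2}1_{r>2t})$; and for $r/t\in[1/2,3/2]$, $|(\partial_t-\partial_r)u-\varepsilon r^{-1}\mu U_q|\lesssim\varepsilon t^{-3/2+C\varepsilon}\langle t-r\rangle^{-1/2}w_0^{-1/2}$. (The main existence theorem of the paper provides such a $u$ for every small $\varepsilon$.) *)

theory Defs
  imports "HOL-Analysis.Analysis"
begin

section \<open>Partial derivatives and regularity up to the boundary\<close>

text \<open>
  All derivatives are Frechet derivatives within the set on which the function lives.  The sets
  used below have tangent cones with nonempty interior at each of their points, so these
  derivatives are unique, also at boundary points.
\<close>

definition pd :: "'a::real_normed_vector set \<Rightarrow> 'a \<Rightarrow> ('a \<Rightarrow> 'b::real_normed_vector) \<Rightarrow> 'a \<Rightarrow> 'b" where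
  "pd S v f x = frechet_derivative f (at x within S) v"

primrec Ck_on :: "nat \<Rightarrow> 'a::euclidean_space set \<Rightarrow> ('a \<Rightarrow> 'b::real_normed_vector) \<Rightarrow> bool" where
  "Ck_on 0 S f \<longleftrightarrow> continuous_on S f"
| "Ck_on (Suc k) S f \<longleftrightarrow> f differentiable_on S \<and> (\<forall>b\<in>Basis. Ck_on k S (pd S b f))"

definition smooth_on :: "'a::euclidean_space set \<Rightarrow> ('a \<Rightarrow> 'b::real_normed_vector) \<Rightarrow> bool" where
  "smooth_on S f \<longleftrightarrow> (\<forall>k. Ck_on k S f)"

definition jb :: "real \<Rightarrow> real" where
  "jb z = sqrt (1 + \<bar>z\<bar>\<^sup>2)"


section \<open>Space-time and the commuting vector fields\<close>

text \<open>
  Points of space-time are pairs \<open>(t, x)\<close>.  The Greek indices \<open>0, \<dots>, 3\<close> are the elements of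
  \<open>3 option\<close>: \<open>None\<close> is the time index \<open>0\<close> and \<open>Some i\<close> is a space index.
\<close>

type_synonym st_index = "3 option"
type_synonym spacetime = "real \<times> (real^3)"

definition st_axis :: "st_index \<Rightarrow> spacetime" where
  "st_axis \<alpha> = (case \<alpha> of None \<Rightarrow> (1, 0) | Some i \<Rightarrow> (0, axis i 1))"

definition upper_half :: "spacetime set" where
  "upper_half = {(t, x). 0 \<le> t}"

definition grad :: "spacetime set \<Rightarrow> (spacetime \<Rightarrow> real^'m) \<Rightarrow> spacetime \<Rightarrow> real^'m^st_index" where
  "grad S \<phi> z = (\<chi> \<alpha>. pd S (st_axis \<alpha>) \<phi> z)"

definition d_t :: "spacetime set \<Rightarrow> (spacetime \<Rightarrow> 'b::real_normed_vector) \<Rightarrow> spacetime \<Rightarrow> 'b" where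
  "d_t S \<phi> z = pd S (st_axis None) \<phi> z"

definition d_r :: "spacetime set \<Rightarrow> (spacetime \<Rightarrow> 'b::real_normed_vector) \<Rightarrow> spacetime \<Rightarrow> 'b" where
  "d_r S \<phi> z = (\<Sum>i\<in>UNIV. (snd z $ i / norm (snd z)) *\<^sub>R pd S (st_axis (Some i)) \<phi> z)"

datatype vfield = Partial st_index | Scaling | Rotation 3 3 | Boost 3

fun Zder :: "spacetime set \<Rightarrow> vfield \<Rightarrow> (spacetime \<Rightarrow> 'b::real_normed_vector) \<Rightarrow> spacetime \<Rightarrow> 'b" where
  "Zder S (Partial \<alpha>) \<phi> z = pd S (st_axis \<alpha>) \<phi> z"
| "Zder S Scaling \<phi> z = fst z *\<^sub>R pd S (st_axis None) \<phi> z
      + (\<Sum>i\<in>UNIV. (snd z $ i) *\<^sub>R pd S (st_axis (Some i)) \<phi> z)"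
| "Zder S (Rotation i j) \<phi> z = (snd z $ i) *\<^sub>R pd S (st_axis (Some j)) \<phi> z
      - (snd z $ j) *\<^sub>R pd S (st_axis (Some i)) \<phi> z"
| "Zder S (Boost i) \<phi> z = (snd z $ i) *\<^sub>R pd S (st_axis None) \<phi> z
      + fst z *\<^sub>R pd S (st_axis (Some i)) \<phi> z"

definition Zprod :: "spacetime set \<Rightarrow> vfield list \<Rightarrow> (spacetime \<Rightarrow> 'b::real_normed_vector) \<Rightarrow> spacetime \<Rightarrow> 'b" where
  "Zprod S I \<phi> = foldr (Zder S) I \<phi>"


section \<open>The quasilinear system\<close>

text \<open>
  A pair \<open>(\<xi>, \<eta>)\<close> in the domain of \<open>g\<close> and \<open>f\<close> stands for \<open>(u, \<partial>u)\<close>, with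
  \<open>\<eta> $ \<alpha> $ J\<close> in the role of the \<open>\<alpha>\<close>-derivative of the \<open>J\<close>-th component.
\<close>

definition quasilinear_system ::
  "(st_index \<Rightarrow> st_index \<Rightarrow> (real^'m) \<times> (real^'m^st_index) \<Rightarrow> real) \<Rightarrow>
   ((real^'m) \<times> (real^'m^st_index) \<Rightarrow> real^'m) \<Rightarrow>
   ('m \<Rightarrow> st_index \<Rightarrow> st_index \<Rightarrow> real) \<Rightarrow>
   ('m \<Rightarrow> st_index \<Rightarrow> st_index \<Rightarrow> st_index \<Rightarrow> real) \<Rightarrow>
   ('m \<Rightarrow> 'm \<Rightarrow> 'm \<Rightarrow> st_index \<Rightarrow> st_index \<Rightarrow> real) \<Rightarrow> bool" where
  "quasilinear_system g f g2 g3 f2 \<longleftrightarrow>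
     (\<forall>\<alpha> \<beta>. g \<alpha> \<beta> = g \<beta> \<alpha>) \<and>
     (\<forall>\<alpha> \<beta>. smooth_on UNIV (g \<alpha> \<beta>)) \<and> smooth_on UNIV f \<and>
     (\<exists>\<rho>>0. \<exists>C. \<forall>\<xi> \<eta>. norm \<xi> < \<rho> \<and> norm \<eta> < \<rho> \<longrightarrow>
        (\<forall>\<alpha> \<beta>. \<bar>g \<alpha> \<beta> (\<xi>, \<eta>)
             - ((if \<alpha> = \<beta> then (if \<alpha> = None then -1 else 1) else 0)
                + (\<Sum>J\<in>UNIV. g2 J \<alpha> \<beta> * \<xi> $ J)
                + (\<Sum>J\<in>UNIV. \<Sum>\<nu>\<in>UNIV. g3 J \<alpha> \<beta> \<nu> * \<eta> $ \<nu> $ J))\<bar>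
           \<le> C * ((norm \<xi>)\<^sup>2 + (norm \<eta>)\<^sup>2)) \<and>
        (\<forall>I. \<bar>f (\<xi>, \<eta>) $ I
             - (\<Sum>J\<in>UNIV. \<Sum>K\<in>UNIV. \<Sum>\<alpha>\<in>UNIV. \<Sum>\<beta>\<in>UNIV.
                  f2 I J K \<alpha> \<beta> * \<eta> $ \<alpha> $ J * \<eta> $ \<beta> $ K)\<bar>
           \<le> C * (norm \<xi> ^ 4 + norm \<eta> * ((norm \<eta>)\<^sup>2 + (norm \<xi>)\<^sup>2))))"

definition QW_solution ::
  "(st_index \<Rightarrow> st_index \<Rightarrow> (real^'m) \<times> (real^'m^st_index) \<Rightarrow> real) \<Rightarrow>
   ((real^'m) \<times> (real^'m^st_index) \<Rightarrow> real^'m) \<Rightarrow> (spacetime \<Rightarrow> real^'m) \<Rightarrow> bool" where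
  "QW_solution g f u \<longleftrightarrow>
     (\<forall>z\<in>upper_half. \<forall>I.
        (\<Sum>\<alpha>\<in>UNIV. \<Sum>\<beta>\<in>UNIV. g \<alpha> \<beta> (u z, grad upper_half u z) *
            pd upper_half (st_axis \<alpha>) (pd upper_half (st_axis \<beta>) u) z $ I)
        = f (u z, grad upper_half u z) $ I)"

definition data_support :: "(spacetime \<Rightarrow> real^'m) \<Rightarrow> (real^3) set" where
  "data_support u = closure {x. u (0, x) \<noteq> 0 \<or> d_t upper_half u (0, x) \<noteq> 0}"


section \<open>The geometric reduced system\<close>

text \<open>
  Functions of \<open>(s, q, \<omega>)\<close> with \<open>\<omega>\<close> in the unit sphere are functions on
  \<open>real \<times> real \<times> (real^3)\<close> whose values off the sphere are irrelevant: they only enter through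
  the extension that is homogeneous of degree zero in the last variable.  Here \<open>sgn y\<close> is
  \<open>y\<close> divided by its norm.
\<close>

type_synonym profile_point = "real \<times> real \<times> (real^3)"

definition profile_dom :: "real \<Rightarrow> profile_point set" where
  "profile_dom \<delta>0 = {-\<delta>0..} \<times> UNIV \<times> sphere 0 1"

definition profile_cone :: "real \<Rightarrow> profile_point set" where
  "profile_cone \<delta>0 = {-\<delta>0..} \<times> UNIV \<times> (- {0})"

definition hom_ext :: "(profile_point \<Rightarrow> 'b) \<Rightarrow> profile_point \<Rightarrow> 'b" where
  "hom_ext W = (\<lambda>(s, q, y). W (s, q, sgn y))"

definition profile_smooth :: "real \<Rightarrow> (profile_point \<Rightarrow> 'b::real_normed_vector) \<Rightarrow> bool" where
  "profile_smooth \<delta>0 W \<longleftrightarrow> smooth_on (profile_cone \<delta>0) (hom_ext W)"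

definition d_s :: "real \<Rightarrow> (profile_point \<Rightarrow> 'b::real_normed_vector) \<Rightarrow> profile_point \<Rightarrow> 'b" where
  "d_s \<delta>0 W = pd (profile_cone \<delta>0) (1, 0, 0) (hom_ext W)"

definition d_q :: "real \<Rightarrow> (profile_point \<Rightarrow> 'b::real_normed_vector) \<Rightarrow> profile_point \<Rightarrow> 'b" where
  "d_q \<delta>0 W = pd (profile_cone \<delta>0) (0, 1, 0) (hom_ext W)"

definition d_\<omega> :: "real \<Rightarrow> 3 \<Rightarrow> (profile_point \<Rightarrow> 'b::real_normed_vector) \<Rightarrow> profile_point \<Rightarrow> 'b" where
  "d_\<omega> \<delta>0 i W = pd (profile_cone \<delta>0) (0, 0, axis i 1) (hom_ext W)"

definition d_sq\<omega> ::
  "real \<Rightarrow> nat \<Rightarrow> nat \<Rightarrow> 3 list \<Rightarrow> (profile_point \<Rightarrow> 'b::real_normed_vector) \<Rightarrow> profile_point \<Rightarrow> 'b" where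
  "d_sq\<omega> \<delta>0 a b c W = (d_s \<delta>0 ^^ a) ((d_q \<delta>0 ^^ b) (foldr (d_\<omega> \<delta>0) c W))"

definition hat :: "real^3 \<Rightarrow> st_index \<Rightarrow> real" where
  "hat \<omega> \<alpha> = (case \<alpha> of None \<Rightarrow> -1 | Some i \<Rightarrow> \<omega> $ i)"

definition G2 :: "('m \<Rightarrow> st_index \<Rightarrow> st_index \<Rightarrow> real) \<Rightarrow> 'm \<Rightarrow> real^3 \<Rightarrow> real" where
  "G2 g2 J \<omega> = (\<Sum>\<alpha>\<in>UNIV. \<Sum>\<beta>\<in>UNIV. g2 J \<alpha> \<beta> * hat \<omega> \<alpha> * hat \<omega> \<beta>)"

definition G3 :: "('m \<Rightarrow> st_index \<Rightarrow> st_index \<Rightarrow> st_index \<Rightarrow> real) \<Rightarrow> 'm \<Rightarrow> real^3 \<Rightarrow> real" where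
  "G3 g3 J \<omega> = (\<Sum>\<alpha>\<in>UNIV. \<Sum>\<beta>\<in>UNIV. \<Sum>\<nu>\<in>UNIV.
      g3 J \<alpha> \<beta> \<nu> * hat \<omega> \<alpha> * hat \<omega> \<beta> * hat \<omega> \<nu>)"

definition F2 ::
  "('m \<Rightarrow> 'm \<Rightarrow> 'm \<Rightarrow> st_index \<Rightarrow> st_index \<Rightarrow> real) \<Rightarrow> 'm \<Rightarrow> 'm \<Rightarrow> 'm \<Rightarrow> real^3 \<Rightarrow> real" where
  "F2 f2 I J K \<omega> = (\<Sum>\<alpha>\<in>UNIV. \<Sum>\<beta>\<in>UNIV. f2 I J K \<alpha> \<beta> * hat \<omega> \<alpha> * hat \<omega> \<beta>)"

definition muUq ::
  "real \<Rightarrow> (profile_point \<Rightarrow> real) \<Rightarrow> (profile_point \<Rightarrow> real^'m) \<Rightarrow> profile_point \<Rightarrow> real^'m" where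
  "muUq \<delta>0 \<mu> U z = \<mu> z *\<^sub>R d_q \<delta>0 U z"

definition reduced_solution ::
  "('m::finite \<Rightarrow> st_index \<Rightarrow> st_index \<Rightarrow> real) \<Rightarrow>
   ('m \<Rightarrow> st_index \<Rightarrow> st_index \<Rightarrow> st_index \<Rightarrow> real) \<Rightarrow>
   ('m \<Rightarrow> 'm \<Rightarrow> 'm \<Rightarrow> st_index \<Rightarrow> st_index \<Rightarrow> real) \<Rightarrow>
   real \<Rightarrow> (profile_point \<Rightarrow> real) \<Rightarrow> (profile_point \<Rightarrow> real^'m) \<Rightarrow> bool" where
  "reduced_solution g2 g3 f2 \<delta>0 \<mu> U \<longleftrightarrow>
     profile_smooth \<delta>0 \<mu> \<and> profile_smooth \<delta>0 U \<and>
     (\<forall>s q \<omega>. (s, q, \<omega>) \<in> profile_dom \<delta>0 \<longrightarrow>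
        (\<forall>I. d_s \<delta>0 (muUq \<delta>0 \<mu> U) (s, q, \<omega>) $ I =
             - (1/4) * (\<Sum>J\<in>UNIV. \<Sum>K\<in>UNIV. F2 f2 I J K \<omega> * (\<mu> (s, q, \<omega>))\<^sup>2
                 * d_q \<delta>0 U (s, q, \<omega>) $ J * d_q \<delta>0 U (s, q, \<omega>) $ K)) \<and>
        d_s \<delta>0 \<mu> (s, q, \<omega>) =
             (1/4) * (\<Sum>J\<in>UNIV. G2 g2 J \<omega> * (\<mu> (s, q, \<omega>))\<^sup>2 * d_q \<delta>0 U (s, q, \<omega>) $ J)
           - (1/8) * (\<Sum>J\<in>UNIV. G3 g3 J \<omega> * (\<mu> (s, q, \<omega>))\<^sup>2
                 * d_q \<delta>0 (muUq \<delta>0 \<mu> U) (s, q, \<omega>) $ J))"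

text \<open>
  Multiplicative constants and exponential rates are separate existentially quantified numbers,
  because \<open>s\<close> takes negative values.  In the first condition a single constant in both roles
  would even be contradictory at \<open>s = -\<delta>0\<close> when \<open>\<delta>0 > exp (-1)\<close>.
\<close>

definition admissible ::
  "('m::finite \<Rightarrow> st_index \<Rightarrow> st_index \<Rightarrow> real) \<Rightarrow>
   ('m \<Rightarrow> st_index \<Rightarrow> st_index \<Rightarrow> st_index \<Rightarrow> real) \<Rightarrow>
   real \<Rightarrow> real \<Rightarrow> real \<Rightarrow> (profile_point \<Rightarrow> real) \<Rightarrow> (profile_point \<Rightarrow> real^'m) \<Rightarrow> bool" where
  "admissible g2 g3 \<gamma>p \<gamma>m \<delta>0 \<mu> U \<longleftrightarrow>
     (let \<gamma> = (\<lambda>q::real. if q \<ge> 0 then \<gamma>p else \<gamma>m) in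
     (\<exists>A>0. \<exists>B. \<forall>(s, q, \<omega>)\<in>profile_dom \<delta>0.
        - A * exp (B * s) \<le> \<mu> (s, q, \<omega>) \<and> \<mu> (s, q, \<omega>) \<le> - (1 / A) * exp (- B * s)) \<and>
     (\<exists>A. \<forall>(s, q, \<omega>)\<in>profile_dom \<delta>0.
        \<bar>d_q \<delta>0 \<mu> (s, q, \<omega>)\<bar> \<le> A * (jb q powr (-1 - \<gamma> q) * \<bar>s * \<mu> (s, q, \<omega>)\<bar>)) \<and>
     (\<exists>A. \<forall>z\<in>profile_dom \<delta>0. norm (muUq \<delta>0 \<mu> U z) \<le> A) \<and>
     (\<exists>A. \<forall>(s, q, \<omega>)\<in>profile_dom \<delta>0.
        (\<Sum>J\<in>UNIV. \<Sum>K\<in>UNIV.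
           \<bar>G3 g3 J \<omega> * \<mu> (s, q, \<omega>) * d_q \<delta>0 (muUq \<delta>0 \<mu> U) (s, q, \<omega>) $ K\<bar>) \<le> A) \<and>
     (\<exists>A. \<forall>(s, q, \<omega>)\<in>profile_dom \<delta>0.
        (\<Sum>J\<in>UNIV. \<Sum>K\<in>UNIV.
           \<bar>G2 g2 J \<omega> * d_q \<delta>0 (muUq \<delta>0 \<mu> U) (s, q, \<omega>) $ K\<bar>) \<le> A * jb q powr (- \<gamma> q)) \<and>
     (\<forall>a b c. \<exists>A B. \<forall>(s, q, \<omega>)\<in>profile_dom \<delta>0.
        \<bar>d_sq\<omega> \<delta>0 a b c (\<lambda>z. \<mu> z + 2) (s, q, \<omega>)\<bar>
          \<le> A * (exp (B * s) * jb q powr (- real b - \<gamma> q))) \<and>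
     (\<forall>a c. \<exists>A B. \<forall>(s, q, \<omega>)\<in>profile_dom \<delta>0.
        norm (d_sq\<omega> \<delta>0 a 0 c U (s, q, \<omega>))
          \<le> A * (exp (B * s) * jb (max 0 (- q)) powr (1 - \<gamma>m))) \<and>
     (\<forall>a b c. \<exists>A B. \<forall>(s, q, \<omega>)\<in>profile_dom \<delta>0.
        norm (d_sq\<omega> \<delta>0 a b c (d_q \<delta>0 U) (s, q, \<omega>))
          \<le> A * (exp (B * s) * jb q powr (- real b - \<gamma> q))))"


section \<open>The optical function and matching at infinite time\<close>

definition exterior :: "real \<Rightarrow> spacetime set" where
  "exterior \<epsilon> = {(t, x). t \<ge> 1 / \<epsilon> \<and> norm x \<ge> t / 2}"

definition in_coords ::
  "real \<Rightarrow> real \<Rightarrow> (spacetime \<Rightarrow> real) \<Rightarrow> (profile_point \<Rightarrow> 'b) \<Rightarrow> spacetime \<Rightarrow> 'b" where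
  "in_coords \<delta> \<epsilon> q W = (\<lambda>(t, x). W (\<epsilon> * ln t - \<delta>, q (t, x), sgn x))"

definition optical_function ::
  "real \<Rightarrow> (profile_point \<Rightarrow> real) \<Rightarrow> real \<Rightarrow> (spacetime \<Rightarrow> real) \<Rightarrow> bool" where
  "optical_function \<delta> \<mu> \<epsilon> q \<longleftrightarrow>
     q differentiable_on exterior \<epsilon> \<and>
     (\<forall>z\<in>exterior \<epsilon>. d_t (exterior \<epsilon>) q z - d_r (exterior \<epsilon>) q z = in_coords \<delta> \<epsilon> q \<mu> z) \<and>
     (\<forall>(t, x)\<in>exterior \<epsilon>. t = 2 * norm x \<longrightarrow> q (t, x) = - norm x)"

definition L2_norm_on :: "(real^3) set \<Rightarrow> (real^3 \<Rightarrow> 'b::real_normed_vector) \<Rightarrow> ennreal" where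
  "L2_norm_on A h =
     (let I = (\<integral>\<^sup>+x\<in>A. ennreal ((norm (h x))\<^sup>2) \<partial>lborel)
      in if I = \<infinity> then \<infinity> else ennreal (sqrt (enn2real I)))"

definition w0 :: "real \<Rightarrow> real \<Rightarrow> real \<Rightarrow> real" where
  "w0 \<gamma>1 t r = (if r \<ge> t then 1 else jb (r - t) powr \<gamma>1)"

text \<open>
  The single constant \<open>C\<close> plays the role of all implicit constants and of all rates
  \<open>C\<epsilon>\<close>; for \<open>\<epsilon> \<le> 1\<close> one has \<open>t \<ge> 1\<close> wherever \<open>t powr (C * \<epsilon>)\<close> occurs.  In the region where
  \<open>r / t\<close> is in \<open>[1/2, 3/2]\<close> the difference of \<open>u\<close> and its approximation is differentiated
  within \<open>exterior \<epsilon>\<close>; elsewhere its (meaningless) value is cut off.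
\<close>

definition matches_with ::
  "real \<Rightarrow> nat \<Rightarrow> real \<Rightarrow> real \<Rightarrow> real \<Rightarrow> (profile_point \<Rightarrow> real) \<Rightarrow> (profile_point \<Rightarrow> real^'m) \<Rightarrow>
   real \<Rightarrow> (spacetime \<Rightarrow> real) \<Rightarrow> (spacetime \<Rightarrow> real^'m) \<Rightarrow> bool" where
  "matches_with C N \<gamma>1 \<delta>0 \<delta> \<mu> U \<epsilon> q u \<longleftrightarrow>
     (let diff = (\<lambda>z. u z - (\<epsilon> / norm (snd z)) *\<^sub>R in_coords \<delta> \<epsilon> q U z);
          near = (\<lambda>t. {x::real^3. 1/2 \<le> norm x / t \<and> norm x / t \<le> 3/2}) in
     (\<forall>I. length I \<le> N - 1 \<longrightarrow>
       (\<forall>t\<ge>1/\<epsilon>.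
          L2_norm_on (near t) (\<lambda>x. (w0 \<gamma>1 t (norm x) powr (1/2)) *\<^sub>R
              grad (exterior \<epsilon>) (Zprod (exterior \<epsilon>) I diff) (t, x))
        + L2_norm_on (- near t) (\<lambda>x. (w0 \<gamma>1 t (norm x) powr (1/2)) *\<^sub>R
              grad upper_half (Zprod upper_half I u) (t, x))
        \<le> ennreal (C * \<epsilon> * t powr (-1/2 + C * \<epsilon>))) \<and>
       (\<forall>t. 0 \<le> t \<and> t \<le> 1/\<epsilon> \<longrightarrow>
          L2_norm_on UNIV (\<lambda>x. (w0 \<gamma>1 t (norm x) powr (1/2)) *\<^sub>R
              grad upper_half (Zprod upper_half I u) (t, x))
        \<le> ennreal (C * \<epsilon>)) \<and>
       (\<forall>t\<ge>1/\<epsilon>. \<forall>x. let r = norm x in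
          norm (grad (exterior \<epsilon>) (Zprod (exterior \<epsilon>) I diff) (t, x)) * indicator (near t) x
        + norm (grad upper_half (Zprod upper_half I u) (t, x)) * indicator (- near t) x
        \<le> C * \<epsilon> * t powr (-1/2 + C * \<epsilon>) * jb (t + r) powr (-1) * jb (t - r) powr (-1/2)
            * w0 \<gamma>1 t r powr (-1/2)) \<and>
       (\<forall>t\<ge>1/\<epsilon>. \<forall>x. let r = norm x in
          norm (Zprod (exterior \<epsilon>) I diff (t, x)) * indicator (near t) x
        + norm (Zprod upper_half I u (t, x)) * indicator (- near t) x
        \<le> C * \<epsilon> * t powr (-1/2 + C * \<epsilon>) *
            (t powr (-1) * jb (r - t) powr (- (\<gamma>1 - 1) / 2) * of_bool (r < t)
             + t powr (-1) * jb (r - t) powr (1/2) * of_bool (t \<le> r \<and> r \<le> 2 * t)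
             + r powr (-1/2) * of_bool (r > 2 * t)))) \<and>
     (\<forall>t\<ge>1/\<epsilon>. \<forall>x\<in>near t. let r = norm x in
        norm (d_t upper_half u (t, x) - d_r upper_half u (t, x)
              - (\<epsilon> / r) *\<^sub>R in_coords \<delta> \<epsilon> q (muUq \<delta>0 \<mu> U) (t, x))
        \<le> C * \<epsilon> * t powr (-3/2 + C * \<epsilon>) * jb (t - r) powr (-1/2) * w0 \<gamma>1 t r powr (-1/2)))"

definition matching_family ::
  "(st_index \<Rightarrow> st_index \<Rightarrow> (real^'m) \<times> (real^'m^st_index) \<Rightarrow> real) \<Rightarrow>
   ((real^'m) \<times> (real^'m^st_index) \<Rightarrow> real^'m) \<Rightarrow> nat \<Rightarrow> real \<Rightarrow> real \<Rightarrow> real \<Rightarrow>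
   (profile_point \<Rightarrow> real) \<Rightarrow> (profile_point \<Rightarrow> real^'m) \<Rightarrow>
   (real \<Rightarrow> spacetime \<Rightarrow> real) \<Rightarrow> (real \<Rightarrow> spacetime \<Rightarrow> real^'m) \<Rightarrow> bool" where
  "matching_family g f N \<gamma>1 \<delta>0 \<delta> \<mu> U q u \<longleftrightarrow>
     (\<exists>C>0. \<forall>\<^sub>F \<epsilon> in at_right 0.
        optical_function \<delta> \<mu> \<epsilon> (q \<epsilon>) \<and>
        Ck_on N upper_half (u \<epsilon>) \<and> QW_solution g f (u \<epsilon>) \<and>
        matches_with C N \<gamma>1 \<delta>0 \<delta> \<mu> U \<epsilon> (q \<epsilon>) (u \<epsilon>))"

end

theory Submission
  imports Defs "HOL-Real_Asymp.Real_Asymp"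
begin

text \<open>
  Along incoming null lines \<open>q' = \<mu>\<close>, and \<open>\<mu> + 2\<close> is integrable in \<open>q\<close> up to a factor
  \<open>t powr (b * \<epsilon>)\<close>, so \<open>q = r - t + O(t powr (b * \<epsilon>))\<close>.  Hence a lower bound on the profile in
  terms of \<open>q\<close> becomes one in terms of \<open>r - t\<close>, and where \<open>\<bar>r - t\<bar> < t powr lam\<close> it beats the
  matching error, which is smaller than \<open>\<epsilon> / t\<close> by almost \<open>t powr (-1/2)\<close>.

  For the supports, compactly supported data force \<open>u\<close> to vanish for \<open>\<bar>x\<bar> > R + t\<close>, which
  contradicts the lower bound at \<open>r = t + t powr lam / 2\<close> for late \<open>t\<close>.  The speed is exactly one
  because \<open>g - m\<close> and \<open>f\<close> vanish at the origin while second derivatives of \<open>u\<close> are locally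
  bounded: \<open>u\<close> satisfies a flat wave inequality \<open>\<bar>\<box>u\<bar> \<le> C (\<bar>u\<bar> + \<bar>\<partial>u\<bar>)\<close> on compact sets, to which the
  standard energy estimate in a backward light cone applies.
\<close>

section \<open>Directional derivatives\<close>

text \<open>The equation for \<open>q\<close> is implicit: \<open>\<mu> + 2\<close> decays in
  \<open>q\<close>, not in the parameter along the line, so it cannot be integrated directly. Since
  \<open>- \<mu>\<close> is positive with a quantitative lower bound, it can serve as the Jacobian
  of the change of variable to \<open>q\<close>, and a bounded primitive of
  \<open>jb q powr (-1 - a)\<close> controls the total deviation.

  All losses are powers of \<open>t\<close> with exponent \<open>O(\<epsilon>)\<close>, while the
  matching error gains a fixed power. In (a), letting \<open>t\<close> grow at fixed \<epsilon>
  settles the competition. In (b) and (c) the bound must hold from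
  \<open>exp ((s0 + \<delta>) / \<epsilon>)\<close> on; there
  \<open>t \<ge> exp (1 / \<epsilon>)\<close> turns the remaining power of \<open>t\<close> into a
  factor \<open>O(\<epsilon>)\<close>, so the threshold depends on \<open>M\<close> but not on
  \<open>s0\<close> or the direction.

  The cone energy is an integral over a fixed box with a C^1 weight that vanishes outside the cone.
  There is no moving domain and no boundary term: differentiation under the integral sign and
  translation invariance replace the divergence theorem.\<close>

lemma pd_has_vector_derivative:
  assumes "\<phi> differentiable_on S" "z + s0 *\<^sub>R v \<in> S" "\<And>s. s \<in> T \<Longrightarrow> z + s *\<^sub>R v \<in> S"
  shows "((\<lambda>s. \<phi> (z + s *\<^sub>R v)) has_vector_derivative pd S v \<phi> (z + s0 *\<^sub>R v)) (at s0 within T)"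
proof -
  let ?D = "frechet_derivative \<phi> (at (z + s0 *\<^sub>R v) within S)"
  have "(\<phi> has_derivative ?D) (at (z + s0 *\<^sub>R v) within S)"
    using assms(1,2) by (simp add: differentiable_on_def frechet_derivative_works)
  moreover have "((\<lambda>s. z + s *\<^sub>R v) has_derivative (\<lambda>s. s *\<^sub>R v)) (at s0 within T)"
    by (auto intro!: derivative_eq_intros)
  ultimately have "(\<phi> \<circ> (\<lambda>s. z + s *\<^sub>R v) has_derivative ?D \<circ> (\<lambda>s. s *\<^sub>R v)) (at s0 within T)"
    by (intro diff_chain_within) (auto intro: has_derivative_subset simp: assms(3) image_subset_iff)
  moreover have "?D (s *\<^sub>R v) = s *\<^sub>R ?D v" for s
    using \<open>(\<phi> has_derivative ?D) _\<close> by (simp add: has_derivative_def linear_scale bounded_linear.linear)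
  ultimately show ?thesis
    by (simp add: has_vector_derivative_def pd_def o_def)
qed

lemma pd_linear_direction:
  assumes "\<phi> differentiable_on S" "z \<in> S"
  shows "linear (\<lambda>v. pd S v \<phi> z)"
proof -
  have "(\<phi> has_derivative frechet_derivative \<phi> (at z within S)) (at z within S)"
    using assms by (simp add: differentiable_on_def frechet_derivative_works)
  then show ?thesis
    unfolding pd_def by (simp add: has_derivative_def bounded_linear.linear)
qed

lemma Ck_on_mono: "Ck_on n S f \<Longrightarrow> m \<le> n \<Longrightarrow> Ck_on m S f"
proof (induction n arbitrary: m f)
  case (Suc n)
  show ?case
  proof (cases m)
    case 0
    then show ?thesis using Suc.prems by (auto intro: differentiable_imp_continuous_on)
  next
    case (Suc k)
    then show ?thesis using Suc.prems Suc.IH by auto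
  qed
qed simp

text \<open>Increments of \<open>u\<close> in direction \<open>w\<close> are integrals of
  \<open>pd S w u\<close>. Differentiating them in direction \<open>v\<close> under the integral
  sign, and then in the endpoint \<open>h\<close>, produces both mixed derivatives.\<close>

lemma pd_commute:
  fixes u :: "'a::euclidean_space \<Rightarrow> 'b::euclidean_space"
  assumes z: "z \<in> interior S"
    and du: "u differentiable_on S" "pd S v u differentiable_on S" "pd S w u differentiable_on S"
    and cont: "continuous_on S (pd S v (pd S w u))"
  shows "pd S w (pd S v u) z = pd S v (pd S w u) z"
proof -
  obtain e where e: "e > 0" "cball z e \<subseteq> S"
    using z mem_interior_cball by blast
  \<comment> \<open>This \<open>d\<close> keeps the parallelogram with coefficients up to
    \<open>d\<close> inside the ball; the summand 1 covers \<open>v = w = 0\<close>.\<close>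
  define d where "d = e / (norm v + norm w + 1)"
  have pos: "norm v + norm w + 1 > 0" by (simp add: add_nonneg_pos)
  have d: "d > 0" unfolding d_def using e pos by simp
  have inS: "z + s *\<^sub>R v + k *\<^sub>R w \<in> S" if "\<bar>s\<bar> \<le> d" "\<bar>k\<bar> \<le> d" for s k
  proof -
    have "norm (s *\<^sub>R v + k *\<^sub>R w) \<le> \<bar>s\<bar> * norm v + \<bar>k\<bar> * norm w"
      by (metis norm_scaleR norm_triangle_ineq)
    also have "\<dots> \<le> d * norm v + d * norm w"
      using that by (intro add_mono mult_right_mono) auto
    also have "\<dots> \<le> d * (norm v + norm w + 1)"
      using d by (simp add: algebra_simps)
    also have "\<dots> = e" using pos by (simp add: d_def)
    finally have "norm (s *\<^sub>R v + k *\<^sub>R w) \<le> e" .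
    then have "dist (z + (s *\<^sub>R v + k *\<^sub>R w)) z \<le> e" by (simp add: dist_norm)
    then have "z + (s *\<^sub>R v + k *\<^sub>R w) \<in> cball z e" by (simp add: dist_commute)
    then show ?thesis using e by (auto simp: add.assoc)
  qed
  have cw: "continuous_on S (pd S w u)" using du differentiable_imp_continuous_on by blast
  \<comment> \<open>Integration over \<open>{0..h}\<close> confines \<open>h\<close> to nonnegative
    values, so the final comparison is one of one-sided derivatives at 0, which are still
    unique.\<close>
  have eq: "pd S v u (z + h *\<^sub>R w) - pd S v u z = integral {0..h} (\<lambda>k. pd S v (pd S w u) (z + k *\<^sub>R w))"
    if h: "h \<in> {0..d}" for h
  proof -
    have ftc: "u (z + s *\<^sub>R v + h *\<^sub>R w) - u (z + s *\<^sub>R v)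
        = integral {0..h} (\<lambda>k. pd S w u (z + s *\<^sub>R v + k *\<^sub>R w))" if s: "s \<in> {-d..d}" for s
    proof -
      have "((\<lambda>k. pd S w u (z + s *\<^sub>R v + k *\<^sub>R w)) has_integral
          (u (z + s *\<^sub>R v + h *\<^sub>R w) - u (z + s *\<^sub>R v + 0 *\<^sub>R w))) {0..h}"
        by (rule fundamental_theorem_of_calculus, use h in simp)
          (rule pd_has_vector_derivative[OF du(1)], use h s in \<open>auto intro!: inS\<close>)
      then show ?thesis by (simp add: integral_unique)
    qed
    \<comment> \<open>This and the direct computation below give two values for the
      \<open>s\<close>-derivative at 0 of the same increment.\<close>
    have "((\<lambda>s. integral (cbox 0 h) (\<lambda>k. pd S w u (z + s *\<^sub>R v + k *\<^sub>R w))) has_vector_derivative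
        integral (cbox 0 h) (\<lambda>k. pd S v (pd S w u) (z + 0 *\<^sub>R v + k *\<^sub>R w))) (at 0 within {-d..d})"
    proof (rule leibniz_rule_vector_derivative)
      fix s k assume sk: "s \<in> {-d..d}" "k \<in> cbox 0 h"
      have "((\<lambda>s. pd S w u ((z + k *\<^sub>R w) + s *\<^sub>R v)) has_vector_derivative
          pd S v (pd S w u) ((z + k *\<^sub>R w) + s *\<^sub>R v)) (at s within {-d..d})"
        by (rule pd_has_vector_derivative[OF du(3)])
          (use sk h inS in \<open>auto simp: add.assoc add.commute[of "k *\<^sub>R w"]\<close>)
      then show "((\<lambda>s. pd S w u (z + s *\<^sub>R v + k *\<^sub>R w)) has_vector_derivative
          pd S v (pd S w u) (z + s *\<^sub>R v + k *\<^sub>R w)) (at s within {-d..d})"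
        by (simp add: algebra_simps)
    next
      fix s assume s: "s \<in> {-d..d}"
      show "(\<lambda>k. pd S w u (z + s *\<^sub>R v + k *\<^sub>R w)) integrable_on cbox 0 h"
        by (rule integrable_continuous, rule continuous_on_compose2[OF cw])
          (use s h in \<open>auto intro!: continuous_intros inS\<close>)
    next
      show "continuous_on ({-d..d} \<times> cbox 0 h) (\<lambda>(s, k). pd S v (pd S w u) (z + s *\<^sub>R v + k *\<^sub>R w))"
        unfolding split_beta
        by (rule continuous_on_compose2[OF cont])
          (use h in \<open>auto intro!: continuous_intros inS\<close>)
    qed (use d in auto)
    then have 1: "((\<lambda>s. integral {0..h} (\<lambda>k. pd S w u (z + s *\<^sub>R v + k *\<^sub>R w))) has_vector_derivative
        integral {0..h} (\<lambda>k. pd S v (pd S w u) (z + k *\<^sub>R w))) (at 0 within {-d..d})"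
      by simp
    have "((\<lambda>s. u ((z + h *\<^sub>R w) + s *\<^sub>R v) - u (z + s *\<^sub>R v)) has_vector_derivative
        pd S v u ((z + h *\<^sub>R w) + 0 *\<^sub>R v) - pd S v u (z + 0 *\<^sub>R v)) (at 0 within {-d..d})"
      by (intro derivative_intros pd_has_vector_derivative[OF du(1)])
        (use h d inS inS[where k=0] inS[where s=0 and k=h] inS[where s=0 and k=0] in
          \<open>auto simp: add.assoc add.commute[of "h *\<^sub>R w"]\<close>)
    from has_vector_derivative_transform[OF _ _ this,
        of "\<lambda>s. integral {0..h} (\<lambda>k. pd S w u (z + s *\<^sub>R v + k *\<^sub>R w))"]
    have 2: "((\<lambda>s. integral {0..h} (\<lambda>k. pd S w u (z + s *\<^sub>R v + k *\<^sub>R w))) has_vector_derivative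
        pd S v u (z + h *\<^sub>R w) - pd S v u z) (at 0 within {-d..d})"
      using ftc d by (simp add: algebra_simps)
    show ?thesis
      using vector_derivative_unique_within[OF _ 2 1] d
      by (simp add: trivial_limit_within islimpt_Icc)
  qed
  have "((\<lambda>h. integral {0..h} (\<lambda>k. pd S v (pd S w u) (z + k *\<^sub>R w))) has_vector_derivative
      pd S v (pd S w u) (z + 0 *\<^sub>R w)) (at 0 within {0..d})"
    by (rule integral_has_vector_derivative, rule continuous_on_compose2[OF cont])
      (use d inS[where s=0] in \<open>auto intro!: continuous_intros\<close>)
  moreover have "((\<lambda>h. pd S v u (z + h *\<^sub>R w) - pd S v u z) has_vector_derivative
      pd S w (pd S v u) (z + 0 *\<^sub>R w) - 0) (at 0 within {0..d})"
    by (intro derivative_intros pd_has_vector_derivative[OF du(2)])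
      (use d inS[where s=0] inS[where s=0 and k=0] in auto)
  from has_vector_derivative_transform[OF _ _ this,
      of "\<lambda>h. integral {0..h} (\<lambda>k. pd S v (pd S w u) (z + k *\<^sub>R w))"]
  have "((\<lambda>h. integral {0..h} (\<lambda>k. pd S v (pd S w u) (z + k *\<^sub>R w))) has_vector_derivative
      pd S w (pd S v u) (z + 0 *\<^sub>R w)) (at 0 within {0..d})"
    using eq d by simp
  ultimately show ?thesis
    using vector_derivative_unique_within[of 0 "{0..d}"] d
    by (force simp: trivial_limit_within islimpt_Icc)
qed

text \<open>Translating a compactly supported function does not change its integral, so the
  derivative of the integral along the translation is 0. The assumption \<open>supp\<close> leaves
  room for translations up to 1, during which the fixed box contains the whole support.\<close>

lemma integral_directional_derivative_eq_0:
  fixes F F' :: "'a::euclidean_space \<Rightarrow> real"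
  assumes der: "\<And>x s. ((\<lambda>s. F (x + s *\<^sub>R v)) has_vector_derivative F' (x + s *\<^sub>R v)) (at s)"
    and cF: "continuous_on UNIV F" and cF': "continuous_on UNIV F'"
    and supp: "\<And>x s. \<bar>s\<bar> \<le> 1 \<Longrightarrow> F (x + s *\<^sub>R v) \<noteq> 0 \<Longrightarrow> x \<in> cbox a b"
  shows "integral (cbox a b) F' = 0"
proof -
  let ?G = "\<lambda>s. integral (cbox a b) (\<lambda>x. F (x + s *\<^sub>R v))"
  have "(?G has_vector_derivative integral (cbox a b) (\<lambda>x. F' (x + 0 *\<^sub>R v))) (at 0 within {-1..1})"
  proof (rule leibniz_rule_vector_derivative)
    show "continuous_on ({-1..1} \<times> cbox a b) (\<lambda>(s, x). F' (x + s *\<^sub>R v))"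
      unfolding split_beta by (rule continuous_on_compose2[OF cF']) (auto intro!: continuous_intros)
    show "(\<lambda>x. F (x + s *\<^sub>R v)) integrable_on cbox a b" for s
      by (rule integrable_continuous, rule continuous_on_compose2[OF cF])
        (auto intro!: continuous_intros)
  qed (auto intro: has_vector_derivative_at_within[OF der])
  moreover have "?G s = integral UNIV F" if "s \<in> {-1..1}" for s
  proof -
    let ?c = "s *\<^sub>R v"
    have "?G s = integral (cbox (a + ?c) (b + ?c)) F"
      using integral_shift_cbox[of "a + ?c" ?c "b + ?c" F] by simp
    also have "\<dots> = integral UNIV (\<lambda>x. if x \<in> cbox (a + ?c) (b + ?c) then F x else 0)"
      by (simp add: integral_restrict_UNIV)
    also have "(\<lambda>x. if x \<in> cbox (a + ?c) (b + ?c) then F x else 0) = F"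
    proof
      fix x
      have "F x \<noteq> 0 \<Longrightarrow> x - ?c \<in> cbox a b"
        using supp[of s "x - ?c"] that by auto
      then show "(if x \<in> cbox (a + ?c) (b + ?c) then F x else 0) = F x"
        by (auto simp: mem_box inner_diff_left inner_add_left algebra_simps)
    qed
    finally show ?thesis .
  qed
  then have "(?G has_vector_derivative 0) (at 0 within {-1..1})"
    by (intro has_vector_derivative_transform[OF _ _ has_vector_derivative_const[of "integral UNIV F"]]) auto
  ultimately show ?thesis
    using vector_derivative_unique_within[of 0 "{-1..1::real}" ?G]
    by (force simp: trivial_limit_within islimpt_Icc)
qed


section \<open>Finite speed of propagation\<close>

lemma has_derivative_path:
  assumes "(W has_derivative D) (at (z + s0 *\<^sub>R v))"
  shows "((\<lambda>s. W (z + s *\<^sub>R v)) has_vector_derivative D v) (at s0 within T)"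
proof -
  have "((\<lambda>s. z + s *\<^sub>R v) has_derivative (\<lambda>s. s *\<^sub>R v)) (at s0 within T)"
    by (auto intro!: derivative_eq_intros)
  then have "((\<lambda>s. W (z + s *\<^sub>R v)) has_derivative (\<lambda>s. D (s *\<^sub>R v))) (at s0 within T)"
    using has_derivative_compose assms by blast
  moreover have "D (s *\<^sub>R v) = s *\<^sub>R D v" for s
    using assms by (simp add: has_derivative_def linear_scale bounded_linear.linear)
  ultimately show ?thesis by (simp add: has_vector_derivative_def)
qed

text \<open>Squaring removes the kink of the positive part: at 0 the difference quotient is at most
  \<open>\<bar>h\<bar>\<close>. This makes the cone weight differentiable across the boundary of the
  cone.\<close>

lemma max_0_power2_has_real_derivative:
  "((\<lambda>y::real. (max 0 y)\<^sup>2) has_real_derivative 2 * max 0 y) (at y)"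
proof -
  consider "y > 0" | "y < 0" | "y = 0" by linarith
  then show ?thesis
  proof cases
    case 1
    have "((\<lambda>y::real. y\<^sup>2) has_real_derivative 2 * max 0 y) (at y)"
      using 1 by (auto intro!: derivative_eq_intros)
    then show ?thesis
      by (rule has_field_derivative_transform_within_open[of _ _ _ "{0<..}"]) (use 1 in auto)
  next
    case 2
    have "((\<lambda>y::real. 0) has_real_derivative 2 * max 0 y) (at y)"
      using 2 by auto
    then show ?thesis
      by (rule has_field_derivative_transform_within_open[of _ _ _ "{..<0}"]) (use 2 in auto)
  next
    case 3
    have "((\<lambda>h::real. (max 0 h)\<^sup>2 / h) \<longlongrightarrow> 0) (at 0)"
    proof (rule Lim_null_comparison)
      show "eventually (\<lambda>h::real. norm ((max 0 h)\<^sup>2 / h) \<le> \<bar>h\<bar>) (at 0)"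
        by (auto simp: max_def power2_eq_square)
      show "((\<lambda>h::real. \<bar>h\<bar>) \<longlongrightarrow> 0) (at 0)"
        by (rule tendsto_rabs_zero) (rule tendsto_ident_at)
    qed
    then show ?thesis using 3 by (simp add: DERIV_def)
  qed
qed

lemma st_axis_in_Basis: "st_axis \<alpha> \<in> Basis"
  by (cases \<alpha>) (auto simp: st_axis_def Basis_prod_def axis_in_Basis_iff image_iff)

lemma sum_st_index: "(\<Sum>\<alpha>\<in>UNIV. F \<alpha>) = F None + (\<Sum>i\<in>UNIV. F (Some i))"
  for F :: "st_index \<Rightarrow> 'a::comm_monoid_add"
  by (simp add: UNIV_option_conv sum.reindex)

lemma norm_Pair_grad_power2:
  "(norm (u z, grad S u z))\<^sup>2 = u z \<bullet> u z + (\<Sum>\<alpha>\<in>UNIV. pd S (st_axis \<alpha>) u z \<bullet> pd S (st_axis \<alpha>) u z)"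
  by (simp add: norm_Pair norm_vec_def[of "grad S u z"] L2_set_def sum_nonneg grad_def power2_norm_eq_inner inner_vec_def)

lemma interior_upper_half: "0 < t \<Longrightarrow> (t, x) \<in> interior upper_half"
  by (rule interiorI[of "{0<..} \<times> UNIV"]) (auto simp: upper_half_def intro!: open_Times)

section \<open>Energy estimate in a backward light cone\<close>

definition wave_op :: "(spacetime \<Rightarrow> 'b::real_normed_vector) \<Rightarrow> spacetime \<Rightarrow> 'b" where
  "wave_op u z = (\<Sum>i\<in>UNIV. pd upper_half (st_axis (Some i)) (pd upper_half (st_axis (Some i)) u) z)
     - pd upper_half (st_axis None) (pd upper_half (st_axis None) u) z"

text \<open>The Lorentzian square of the displacement from the apex \<open>(\<rho>, X)\<close>: up
  to time \<rho> it is positive exactly inside the backward cone. Being polynomial, it avoids the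
  singularity of \<open>norm\<close> on the axis.\<close>

definition cone_fun :: "real \<Rightarrow> real^3 \<Rightarrow> spacetime \<Rightarrow> real" where
  "cone_fun \<rho> X z = (\<rho> - fst z)\<^sup>2 - (snd z - X) \<bullet> (snd z - X)"

text \<open>The time part carries the factor \<open>\<rho> - t\<close>, the space part
  \<open>x - X\<close>. Inside the cone the first dominates the second, which is what later absorbs
  the energy flux.\<close>

lemma cone_fun_weight_derivative:
  "((\<lambda>s. (max 0 (cone_fun \<rho> X (z + s *\<^sub>R v)))\<^sup>2) has_vector_derivative
     - 4 * max 0 (cone_fun \<rho> X (z + s0 *\<^sub>R v)) *
       ((\<rho> - fst (z + s0 *\<^sub>R v)) * fst v + (snd (z + s0 *\<^sub>R v) - X) \<bullet> snd v)) (at s0 within T)"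
proof -
  let ?z = "z + s0 *\<^sub>R v"
  have "((\<lambda>z. (\<rho> - fst z)\<^sup>2 - (snd z - X) \<bullet> (snd z - X)) has_derivative
      (\<lambda>w. - 2 * ((\<rho> - fst ?z) * fst w + (snd ?z - X) \<bullet> snd w))) (at ?z)"
    by (auto intro!: derivative_eq_intros simp: fun_eq_iff inner_commute algebra_simps)
  then have "(cone_fun \<rho> X has_derivative
      (\<lambda>w. - 2 * ((\<rho> - fst ?z) * fst w + (snd ?z - X) \<bullet> snd w))) (at ?z)"
    unfolding cone_fun_def .
  from has_derivative_compose[OF this max_0_power2_has_real_derivative[unfolded has_field_derivative_def]]
  have "((\<lambda>z. (max 0 (cone_fun \<rho> X z))\<^sup>2) has_derivative
      (\<lambda>w. 2 * max 0 (cone_fun \<rho> X ?z) * (- 2 * ((\<rho> - fst ?z) * fst w + (snd ?z - X) \<bullet> snd w)))) (at ?z)" .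
  from has_derivative_path[OF this] show ?thesis by (simp add: algebra_simps)
qed

lemma cone_fun_pos_imp:
  assumes "cone_fun \<rho> X z > 0" "fst z \<le> \<rho>"
  shows "norm (snd z - X) < \<rho> - fst z"
  using assms unfolding cone_fun_def
  by (metis dot_square_norm diff_ge_0_iff_ge diff_gt_0_iff_gt power2_less_imp_less)

text \<open>The density \<open>e\<close> contains \<open>u z \<bullet> u z\<close> besides the
  derivatives, so the right-hand side of the wave inequality is controlled by \<open>e\<close>
  itself and a Gronwall argument closes.\<close>

theorem wave_finite_speed:
  fixes u :: "spacetime \<Rightarrow> real^'m"
  assumes C2: "Ck_on 2 upper_half u"
    and wave: "\<And>K. compact K \<Longrightarrow> K \<subseteq> upper_half \<Longrightarrow>
        \<exists>C. \<forall>z\<in>K. norm (wave_op u z) \<le> C * norm (u z, grad upper_half u z)"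
    and data: "\<And>x. norm x > R \<Longrightarrow> u (0, x) = 0 \<and> d_t upper_half u (0, x) = 0"
    and T: "0 \<le> T" and X: "norm X > R + T"
  shows "u (T, X) = 0"
proof -
  define A where "A \<alpha> = pd upper_half (st_axis \<alpha>) u" for \<alpha>
  define A2 where "A2 \<alpha> \<beta> = pd upper_half (st_axis \<beta>) (A \<alpha>)" for \<alpha> \<beta>
  \<comment> \<open>Midpoint of \<open>T\<close> and \<open>norm X - R\<close>: the apex lies
    strictly above \<open>(T, X)\<close>, so the weight is positive there, and the base of the cone
    stays outside the ball of radius \<open>R\<close>.\<close>
  define \<rho> where "\<rho> = (norm X - R + T) / 2"
  have \<rho>: "T < \<rho>" "\<rho> < norm X - R" using X by (auto simp: \<rho>_def)
  define m where "m z = max 0 (cone_fun \<rho> X z)" for z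
  define e where "e z = (u z \<bullet> u z + (\<Sum>\<alpha>\<in>UNIV. A \<alpha> z \<bullet> A \<alpha> z)) / 2" for z
  define e' where "e' z = u z \<bullet> A None z + (\<Sum>\<alpha>\<in>UNIV. A \<alpha> z \<bullet> A2 \<alpha> None z)" for z
  \<comment> \<open>\<open>I'\<close> is the time derivative of the weighted density,
    \<open>F i\<close> the weighted energy flux and \<open>F' i\<close> its derivative in direction
    \<open>i\<close>.\<close>
  define I' where "I' z = - 4 * m z * (\<rho> - fst z) * e z + (m z)\<^sup>2 * e' z" for z
  define F where "F i z = (m z)\<^sup>2 * (A None z \<bullet> A (Some i) z)" for i z
  define F' where "F' i z = - 4 * m z * (snd z - X) $ i * (A None z \<bullet> A (Some i) z)
    + (m z)\<^sup>2 * (A2 None (Some i) z \<bullet> A (Some i) z + A None z \<bullet> A2 (Some i) (Some i) z)" for i z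
  have C2': "Ck_on (Suc (Suc 0)) upper_half u"
    using C2 by (simp only: numeral_2_eq_2)
  have du: "u differentiable_on upper_half" using C2' by simp
  have dA: "A \<alpha> differentiable_on upper_half" for \<alpha>
    using C2' st_axis_in_Basis[of \<alpha>] unfolding A_def by simp
  have cA2: "continuous_on upper_half (A2 \<alpha> \<beta>)" for \<alpha> \<beta>
    using C2' st_axis_in_Basis unfolding A_def A2_def by simp
  have cu: "continuous_on upper_half u" and cA: "continuous_on upper_half (A \<alpha>)" for \<alpha>
    using du dA differentiable_imp_continuous_on by blast+
  have cm: "continuous_on upper_half m"
    unfolding m_def cone_fun_def by (intro continuous_intros)
  have ce: "continuous_on upper_half e"
    unfolding e_def by (intro continuous_intros cu cA) simp
  have cme: "continuous_on upper_half (\<lambda>z. (m z)\<^sup>2 * e z)"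
    by (intro continuous_intros cm ce)
  have cI': "continuous_on upper_half I'"
    unfolding I'_def e'_def by (intro continuous_intros cu cA cA2 ce cm) 
  have cF: "continuous_on upper_half (F i)" for i
    unfolding F_def by (intro continuous_intros cu cA cA2 ce cm) 
  have cF': "continuous_on upper_half (F' i)" for i
    unfolding F'_def by (intro continuous_intros cu cA cA2 ce cm) 
  have m_nonneg: "m z \<ge> 0" for z by (simp add: m_def)
  have e_nonneg: "e z \<ge> 0" for z by (simp add: e_def sum_nonneg add_nonneg_nonneg)
  have e_norm: "e z = (norm (u z, grad upper_half u z))\<^sup>2 / 2" for z
    by (simp add: norm_Pair_grad_power2 e_def A_def)
  have m_pos: "norm (snd z - X) < \<rho> - fst z" if "m z \<noteq> 0" "fst z \<le> T" for z
    using cone_fun_pos_imp[of \<rho> X z] that \<rho> by (auto simp: m_def max_def split: if_splits)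
  \<comment> \<open>The extra 1 is the room for translations that
    \<open>integral_directional_derivative_eq_0\<close> asks for.\<close>
  obtain a where a: "cball X (\<rho> + 1) \<subseteq> cbox (-a) a"
    using bounded_subset_cbox_symmetric[OF bounded_cball] by blast
  define B where "B = cbox (-a) a"
  define En where "En t = integral B (\<lambda>x. (m (t, x))\<^sup>2 * e (t, x))" for t
  have sub: "{0..T} \<times> B \<subseteq> upper_half" by (auto simp: upper_half_def)
  have t_axis: "(0, x) + t *\<^sub>R st_axis None = (t, x)" for t x by (simp add: st_axis_def)
  have x_axis: "(t, x + s *\<^sub>R axis i 1) = (t, x) + s *\<^sub>R st_axis (Some i)" for s t x i
    by (simp add: st_axis_def)
  have path_m: "((\<lambda>s. (m (z + s *\<^sub>R v))\<^sup>2) has_vector_derivative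
     - 4 * m (z + s0 *\<^sub>R v) *
       ((\<rho> - fst (z + s0 *\<^sub>R v)) * fst v + (snd (z + s0 *\<^sub>R v) - X) \<bullet> snd v)) (at s0 within W)"
    for z v s0 W
    unfolding m_def by (rule cone_fun_weight_derivative)
  note path_inner = bounded_bilinear.has_vector_derivative[OF bounded_bilinear_inner]
  have cts: "continuous_on B (\<lambda>x. W (t, x))"
    if "continuous_on upper_half W" "t \<ge> 0" for W :: "spacetime \<Rightarrow> real" and t
    by (rule continuous_on_compose2[OF that(1)])
      (use that in \<open>auto simp: upper_half_def intro!: continuous_intros\<close>)
  have int: "(\<lambda>x. W (t, x)) integrable_on B"
    if "continuous_on upper_half W" "t \<ge> 0" for W :: "spacetime \<Rightarrow> real" and t
    using cts[OF that] unfolding B_def by (rule integrable_continuous)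
  have der_En: "(En has_vector_derivative integral B (\<lambda>x. I' (t, x))) (at t within {0..T})"
    if t: "t \<in> {0..T}" for t
    unfolding En_def B_def
  proof (rule leibniz_rule_vector_derivative)
    fix t x assume t: "t \<in> {0..T}"
    have in_S: "(0, x) + s *\<^sub>R st_axis None \<in> upper_half" if "s \<in> {0..T}" for s
      using that by (simp add: t_axis upper_half_def)
    note pu = pd_has_vector_derivative[OF du in_S[OF t], of "{0..T}"]
    note pA = pd_has_vector_derivative[OF dA in_S[OF t], of "{0..T}"]
    have "((\<lambda>s. (u ((0, x) + s *\<^sub>R st_axis None) \<bullet> u ((0, x) + s *\<^sub>R st_axis None) +
          (\<Sum>\<alpha>\<in>UNIV. A \<alpha> ((0, x) + s *\<^sub>R st_axis None) \<bullet> A \<alpha> ((0, x) + s *\<^sub>R st_axis None))) / 2)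
        has_vector_derivative e' ((0, x) + t *\<^sub>R st_axis None)) (at t within {0..T})"
      by (rule has_vector_derivative_eq_rhs,
          rule has_vector_derivative_divide[OF has_vector_derivative_add
            [OF path_inner[OF pu pu] has_vector_derivative_sum[OF path_inner[OF pA pA]]]])
        (simp_all add: in_S e'_def A_def[symmetric] A2_def[symmetric] inner_commute sum.distrib flip: sum_distrib_left)
    then have "((\<lambda>s. e ((0, x) + s *\<^sub>R st_axis None)) has_vector_derivative
        e' ((0, x) + t *\<^sub>R st_axis None)) (at t within {0..T})"
      by (simp add: e_def)
    from has_vector_derivative_mult[OF path_m[of "(0, x)" "st_axis None" t "{0..T}"] this]
    show "((\<lambda>t. (m (t, x))\<^sup>2 * e (t, x)) has_vector_derivative I' (t, x)) (at t within {0..T})"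
      unfolding t_axis by (simp add: I'_def st_axis_def algebra_simps)
  next
    fix t assume "t \<in> {0..T}"
    then show "(\<lambda>x. (m (t, x))\<^sup>2 * e (t, x)) integrable_on cbox (-a) a"
      using int[OF cme, of t] by (simp add: B_def)
  next
    show "continuous_on ({0..T} \<times> cbox (-a) a) (\<lambda>(t, x). I' (t, x))"
      using continuous_on_subset[OF cI' sub] by (simp add: B_def)
  qed (use t in auto)
  have div0: "integral B (\<lambda>x. F' i (t, x)) = 0" if t: "t \<in> {0..T}" for t i
    unfolding B_def
  proof (rule integral_directional_derivative_eq_0[where v="axis i 1" and F="\<lambda>x. F i (t, x)"])
    have in_S: "(t, x) \<in> upper_half" for x using t by (simp add: upper_half_def)
    fix x s
    have in_S': "(t, x) + s *\<^sub>R st_axis (Some i) \<in> upper_half" for s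
      using t by (simp add: st_axis_def upper_half_def)
    note pA = pd_has_vector_derivative[OF dA in_S'[of s], of UNIV]
    have "((\<lambda>s. F i ((t, x) + s *\<^sub>R st_axis (Some i))) has_vector_derivative
        F' i ((t, x) + s *\<^sub>R st_axis (Some i))) (at s)"
      unfolding F_def
      by (rule has_vector_derivative_eq_rhs,
          rule has_vector_derivative_mult[OF path_m path_inner[OF pA pA]])
        (use in_S' in \<open>auto simp: F'_def A2_def st_axis_def inner_axis algebra_simps\<close>)
    then show "((\<lambda>s. F i (t, x + s *\<^sub>R axis i 1)) has_vector_derivative F' i (t, x + s *\<^sub>R axis i 1)) (at s)"
      by (simp add: x_axis)
    show "continuous_on UNIV (\<lambda>x. F i (t, x))" "continuous_on UNIV (\<lambda>x. F' i (t, x))"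
      by (rule continuous_on_compose2[OF cF] continuous_on_compose2[OF cF'];
          use in_S in \<open>auto intro!: continuous_intros\<close>)+
    assume s: "\<bar>s\<bar> \<le> 1" and "F i (t, x + s *\<^sub>R axis i 1) \<noteq> 0"
    then have "norm (x + s *\<^sub>R axis i 1 - X) < \<rho>"
      using m_pos[of "(t, x + s *\<^sub>R axis i 1)"] t by (auto simp: F_def)
    moreover have "norm (x - X) \<le> norm (x + s *\<^sub>R axis i 1 - X) + norm (s *\<^sub>R axis i (1::real) :: real^3)"
      using norm_triangle_ineq4[of "x + s *\<^sub>R axis i 1 - X" "s *\<^sub>R axis i 1"] by (simp add: algebra_simps)
    ultimately have "dist X x \<le> \<rho> + 1"
      using s by (simp add: dist_norm norm_minus_commute)
    then show "x \<in> cbox (-a) a" using a by auto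
  qed
  obtain C0 where C0: "\<And>z. z \<in> {0..T} \<times> B \<Longrightarrow> norm (wave_op u z) \<le> C0 * norm (u z, grad upper_half u z)"
    using wave[OF _ sub] by (auto simp: B_def compact_Times)
  define C where "C = 2 * (1 + \<bar>C0\<bar>)"
  \<comment> \<open>Times are positive here because mixed derivatives are exchanged at interior
    points.\<close>
  have rest: "I' z \<le> (\<Sum>i\<in>UNIV. F' i z) + C * ((m z)\<^sup>2 * e z)"
    if t: "0 < fst z" "fst z \<le> T" and B: "snd z \<in> B" for z
  proof -
    have comm: "A2 None (Some i) z = A2 (Some i) None z" for i
      unfolding A2_def A_def
      by (rule pd_commute)
        (use interior_upper_half[of "fst z" "snd z"] t du dA cA2 in \<open>auto simp: A_def A2_def\<close>)
    have wop: "wave_op u z = (\<Sum>i\<in>UNIV. A2 (Some i) (Some i) z) - A2 None None z"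
      by (simp add: wave_op_def A2_def A_def)
    define y where "y = snd z - X"
    define N where "N = norm (u z, grad upper_half u z)"
    define G where "G = L2_set (\<lambda>i. norm (A (Some i) z)) UNIV"
    have e2: "2 * e z = (norm (u z))\<^sup>2 + (norm (A None z))\<^sup>2 + G\<^sup>2"
      by (simp add: e_def sum_st_index G_def L2_set_def sum_nonneg power2_norm_eq_inner)
    \<comment> \<open>The mixed derivatives cancel, and the pure second derivatives combine to
      \<open>wave_op u z\<close> tested against the time derivative.\<close>
    have I'_eq: "I' z - (\<Sum>i\<in>UNIV. F' i z) =
      - 4 * m z * ((\<rho> - fst z) * e z - (\<Sum>i\<in>UNIV. y $ i * (A None z \<bullet> A (Some i) z)))
      + (m z)\<^sup>2 * (u z \<bullet> A None z - A None z \<bullet> wave_op u z)"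
    proof -
      have 1: "(\<Sum>i\<in>UNIV. F' i z) = - 4 * m z * (\<Sum>i\<in>UNIV. y $ i * (A None z \<bullet> A (Some i) z))
          + (m z)\<^sup>2 * ((\<Sum>i\<in>UNIV. A2 None (Some i) z \<bullet> A (Some i) z)
             + (\<Sum>i\<in>UNIV. A None z \<bullet> A2 (Some i) (Some i) z))"
        by (simp add: F'_def y_def sum.distrib sum_distrib_left mult.assoc distrib_left sum_subtractf sum_negf)
      have 2: "A None z \<bullet> wave_op u z
          = (\<Sum>i\<in>UNIV. A None z \<bullet> A2 (Some i) (Some i) z) - A None z \<bullet> A2 None None z"
        by (simp add: wop inner_diff_right inner_sum_right)
      have 3: "e' z = u z \<bullet> A None z + (A None z \<bullet> A2 None None z
          + (\<Sum>i\<in>UNIV. A2 None (Some i) z \<bullet> A (Some i) z))"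
        by (simp add: e'_def sum_st_index comm inner_commute)
      show ?thesis unfolding I'_def 1 2 3 by (simp add: algebra_simps)
    qed
    have N2: "N\<^sup>2 = 2 * e z" and N0: "0 \<le> N" by (simp_all add: N_def e_norm)
    have A0: "norm (A None z) \<le> N" and u0: "norm (u z) \<le> N"
      by (rule power2_le_imp_le[OF _ N0], unfold N2 e2, simp)+
    \<comment> \<open>The flux created by the spatial gradient of the weight is absorbed by the
      decrease of the weight in time: where the weight is nonzero,
      \<open>norm y \<le> \<rho> - fst z\<close>, and the product of time and space derivatives is
      at most \<open>e z\<close>.\<close>
    have "m z * (\<Sum>i\<in>UNIV. y $ i * (A None z \<bullet> A (Some i) z)) \<le> m z * ((\<rho> - fst z) * e z)"
    proof (cases "m z = 0")
      case False
      then have yl: "norm y \<le> \<rho> - fst z" using m_pos[of z] t by (simp add: y_def)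
      have "(\<Sum>i\<in>UNIV. y $ i * (A None z \<bullet> A (Some i) z))
          \<le> (\<Sum>i\<in>UNIV. norm (A None z) * (\<bar>y $ i\<bar> * \<bar>norm (A (Some i) z)\<bar>))"
      proof (rule sum_mono)
        fix i
        have "y $ i * (A None z \<bullet> A (Some i) z) \<le> \<bar>y $ i\<bar> * \<bar>A None z \<bullet> A (Some i) z\<bar>"
          by (metis abs_ge_self abs_mult)
        also have "\<dots> \<le> \<bar>y $ i\<bar> * (norm (A None z) * norm (A (Some i) z))"
          by (intro mult_left_mono Cauchy_Schwarz_ineq2) simp
        finally show "y $ i * (A None z \<bullet> A (Some i) z) \<le> norm (A None z) * (\<bar>y $ i\<bar> * \<bar>norm (A (Some i) z)\<bar>)"
          by (simp add: mult_ac)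
      qed
      also have "\<dots> = norm (A None z) * (\<Sum>i\<in>UNIV. \<bar>y $ i\<bar> * \<bar>norm (A (Some i) z)\<bar>)"
        by (simp add: sum_distrib_left)
      also have "\<dots> \<le> norm (A None z) * (norm y * G)"
        using L2_set_mult_ineq[of "\<lambda>i. y $ i" "\<lambda>i. norm (A (Some i) z)" UNIV]
        by (intro mult_left_mono) (simp_all add: norm_vec_def[of y] G_def L2_set_def)
      also have "\<dots> = norm y * (norm (A None z) * G)" by simp
      also have "\<dots> \<le> norm y * e z"
      proof (rule mult_left_mono)
        show "norm (A None z) * G \<le> e z"
          using e2 sum_squares_bound[of "norm (A None z)" G] zero_le_power2[of "norm (u z)"]
          by linarith
      qed simp
      also have "\<dots> \<le> (\<rho> - fst z) * e z"
        using yl e_nonneg by (intro mult_right_mono)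
      finally show ?thesis using m_nonneg by (intro mult_left_mono)
    qed simp
    \<comment> \<open>Both terms are bounded by multiples of \<open>N\<^sup>2 = 2 * e z\<close>,
      whence the factor 2 in \<open>C\<close>.\<close>
    moreover have "u z \<bullet> A None z - A None z \<bullet> wave_op u z \<le> C * e z"
    proof -
      have "z \<in> {0..T} \<times> B" using t B by (simp add: mem_Times_iff)
      then have "norm (wave_op u z) \<le> C0 * N" unfolding N_def by (rule C0)
      also have "\<dots> \<le> \<bar>C0\<bar> * N" by (intro mult_right_mono N0 abs_ge_self)
      finally have w: "norm (wave_op u z) \<le> \<bar>C0\<bar> * N" .
      have "u z \<bullet> A None z \<le> N * N"
        using norm_cauchy_schwarz[of "u z" "A None z"] mult_mono[OF u0 A0 N0 norm_ge_zero] by linarith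
      moreover have "\<bar>A None z \<bullet> wave_op u z\<bar> \<le> N * (\<bar>C0\<bar> * N)"
        using Cauchy_Schwarz_ineq2[of "A None z" "wave_op u z"] mult_mono[OF A0 w N0 norm_ge_zero]
        by linarith
      ultimately have "u z \<bullet> A None z - A None z \<bullet> wave_op u z \<le> N * N + N * (\<bar>C0\<bar> * N)"
        by linarith
      also have "\<dots> = (1 + \<bar>C0\<bar>) * N\<^sup>2" by (simp add: power2_eq_square algebra_simps)
      also have "\<dots> = C * e z" by (simp add: C_def N2)
      finally show ?thesis .
    qed
    then have "(m z)\<^sup>2 * (u z \<bullet> A None z - A None z \<bullet> wave_op u z) \<le> (m z)\<^sup>2 * (C * e z)"
      by (intro mult_left_mono) simp_all
    ultimately show ?thesis using I'_eq by (simp add: algebra_simps)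
  qed
  have intC: "(\<lambda>x. C * ((m (t, x))\<^sup>2 * e (t, x))) integrable_on B" if "t \<ge> 0" for t
    using integrable_cmul[OF int[OF cme that], of C] by simp
  have deriv_le: "integral B (\<lambda>x. I' (t, x)) \<le> C * En t" if t: "0 < t" "t < T" for t
  proof -
    have "integral B (\<lambda>x. I' (t, x)) \<le> integral B (\<lambda>x. (\<Sum>i\<in>UNIV. F' i (t, x)) + C * ((m (t, x))\<^sup>2 * e (t, x)))"
      by (intro integral_le integrable_add integrable_sum int[OF cI'] int[OF cF']
          intC rest)
        (use t in auto)
    also have "\<dots> = (\<Sum>i\<in>UNIV. integral B (\<lambda>x. F' i (t, x))) + C * En t"
      unfolding En_def
      by (subst Henstock_Kurzweil_Integration.integral_add)
        (use t int[OF cF'] intC in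
         \<open>auto intro!: integrable_sum
           simp: Henstock_Kurzweil_Integration.integral_sum\<close>)
    also have "\<dots> = C * En t" using div0 t by simp
    finally show ?thesis .
  qed
  \<comment> \<open>Gronwall: the integrating factor turns \<open>deriv_le\<close> into
    monotonicity. At the endpoints continuity is enough, so restricting the pointwise inequality to
    positive times does no harm.\<close>
  have "exp (- C * T) * En T \<le> exp (- C * 0) * En 0"
  proof (rule DERIV_nonpos_imp_decreasing_open[OF T])
    have "continuous_on {0..T} En"
      unfolding continuous_on_eq_continuous_within
      by (blast intro: has_vector_derivative_continuous[OF der_En])
    then show "continuous_on {0..T} (\<lambda>t. exp (- C * t) * En t)"
      by (intro continuous_intros)
    fix t assume t: "0 < t" "t < T"
    then have "(En has_vector_derivative integral B (\<lambda>x. I' (t, x))) (at t within {0<..<T})"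
      by (intro has_vector_derivative_within_subset[OF der_En]) auto
    then have "(En has_real_derivative integral B (\<lambda>x. I' (t, x))) (at t)"
      unfolding has_real_derivative_iff_has_vector_derivative
      using at_within_open[of t "{0<..<T}"] t by simp
    then have "((\<lambda>t. exp (- C * t) * En t) has_real_derivative
        exp (- C * t) * (integral B (\<lambda>x. I' (t, x)) - C * En t)) (at t)"
      by (auto intro!: derivative_eq_intros simp: algebra_simps)
    moreover have "exp (- C * t) * (integral B (\<lambda>x. I' (t, x)) - C * En t) \<le> 0"
      using deriv_le[OF t] by (intro mult_nonneg_nonpos) auto
    ultimately show "\<exists>y. ((\<lambda>t. exp (- C * t) * En t) has_real_derivative y) (at t) \<and> y \<le> 0"
      by blast
  qed
  moreover have "En 0 = 0"
  proof -
    have "(m (0, x))\<^sup>2 * e (0, x) = 0" for x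
    proof (cases "m (0, x) = 0")
      case False
      then have "norm (x - X) < \<rho>" using m_pos[of "(0, x)"] T by auto
      then have x: "norm x > R" using \<rho> norm_triangle_ineq4[of x "x - X"] by simp
      \<comment> \<open>\<open>u (0, _)\<close> vanishes on a whole neighbourhood of
        \<open>x\<close>, so its spatial derivatives vanish too.\<close>
      have "A (Some i) (0, x) = 0" for i
      proof -
        have "((\<lambda>s. u ((0, x) + s *\<^sub>R st_axis (Some i))) has_vector_derivative
            A (Some i) ((0, x) + 0 *\<^sub>R st_axis (Some i))) (at 0)"
          unfolding A_def by (rule pd_has_vector_derivative[OF du]) (auto simp: st_axis_def upper_half_def)
        moreover have "((\<lambda>s. u ((0, x) + s *\<^sub>R st_axis (Some i))) has_vector_derivative 0) (at 0)"
        proof (rule has_vector_derivative_transform_within_open[OF has_vector_derivative_const[of 0]])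
          show "open {s. norm (x + s *\<^sub>R axis i 1) > R}"
            by (intro open_Collect_less continuous_intros)
        qed (use x data in \<open>auto simp: st_axis_def\<close>)
        ultimately have "A (Some i) ((0, x) + 0 *\<^sub>R st_axis (Some i)) = 0"
          by (rule vector_derivative_unique_at)
        then show ?thesis by simp
      qed
      then show ?thesis using data[OF x] by (simp add: e_def sum_st_index A_def d_t_def)
    qed simp
    then have "(\<lambda>x. (m (0, x))\<^sup>2 * e (0, x)) = (\<lambda>x. 0)" by (rule ext)
    then show ?thesis unfolding En_def by (simp only: integral_0)
  qed
  moreover have "En T \<ge> 0"
    unfolding En_def using T e_nonneg by (intro integral_nonneg int[OF cme]) auto
  ultimately have "En T = 0"
    by (simp add: mult_le_0_iff)
  then have *: "((\<lambda>x. (m (T, x))\<^sup>2 * e (T, x)) has_integral 0) (cbox (-a) a)"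
    using int[OF cme T] by (simp add: En_def B_def has_integral_iff)
  \<comment> \<open>Having an interior point, the box is nondegenerate; a continuous nonnegative
    integrand with integral 0 then vanishes at every point, in particular at
    \<open>X\<close>.\<close>
  have "ball X (\<rho> + 1) \<subseteq> box (-a) a"
    using interior_mono[OF a] by simp
  then have "X \<in> box (-a) a" using \<rho> T by auto
  then have "(m (T, X))\<^sup>2 * e (T, X) = 0"
    using has_integral_0_cbox_imp_0[OF _ _ *, of X] cts[OF cme T] box_subset_cbox[of "-a" a]
    by (auto simp: B_def e_nonneg)
  moreover have "m (T, X) \<noteq> 0" using \<rho> by (simp add: m_def cone_fun_def max_def)
  ultimately have "e (T, X) = 0" by simp
  then show ?thesis by (simp add: e_norm norm_Pair_grad_power2[symmetric] prod_eq_iff)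
qed

section \<open>A flat wave inequality for the quasilinear system\<close>

lemma vanishing_at_0_linear_bound:
  fixes G :: "'a::real_normed_vector \<Rightarrow> 'b::real_normed_vector"
  assumes "G differentiable (at 0)" "continuous_on P G" "G 0 = 0" "compact P"
  shows "\<exists>C. \<forall>p\<in>P. norm (G p) \<le> C * norm p"
proof -
  obtain D where D: "(G has_derivative D) (at 0)" using assms by (auto simp: differentiable_def)
  then obtain d where d: "d > 0" "\<And>p. norm p < d \<Longrightarrow> norm (G p - D p) \<le> norm p"
    using assms(3) unfolding has_derivative_at_alt
    by (metis diff_zero mult_1 zero_less_one)
  obtain k where k: "\<And>p. norm (D p) \<le> norm p * k" "k > 0"
    using D has_derivative_bounded_linear bounded_linear.pos_bounded by metis
  obtain b where b: "\<And>p. p \<in> P \<Longrightarrow> norm (G p) \<le> b" 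
    using compact_imp_bounded[OF compact_continuous_image[OF assms(2,4)]] by (auto simp: bounded_iff)
  \<comment> \<open>Near 0 the differential gives slope \<open>1 + k\<close>; off the ball of radius
    \<open>d\<close> the plain bound \<open>b\<close> is worth slope
    \<open>\<bar>b\<bar> / d\<close>.\<close>
  have "norm (G p) \<le> (1 + k + \<bar>b\<bar> / d) * norm p" if "p \<in> P" for p
  proof (cases "norm p < d")
    case True
    have "norm (G p) \<le> norm (G p - D p) + norm (D p)"
      using norm_triangle_ineq[of "G p - D p" "D p"] by simp
    also have "\<dots> \<le> norm p + norm p * k" using d(2)[OF True] k(1) by (rule add_mono)
    also have "\<dots> \<le> (1 + k + \<bar>b\<bar> / d) * norm p" using d by (simp add: algebra_simps)
    finally show ?thesis .
  next
    case False
    have "norm (G p) \<le> \<bar>b\<bar> / d * d" using b[OF that] d by simp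
    also have "\<dots> \<le> \<bar>b\<bar> / d * norm p" using False d by (intro mult_left_mono) auto
    also have "\<dots> \<le> (1 + k + \<bar>b\<bar> / d) * norm p" using k by (intro mult_right_mono) auto
    finally show ?thesis .
  qed
  then show ?thesis by blast
qed

lemma smooth_on_UNIV_differentiable:
  assumes "smooth_on UNIV G"
  shows "G differentiable (at p)" "continuous_on S G"
proof -
  have "Ck_on (Suc 0) UNIV G" "Ck_on 0 UNIV G" using assms unfolding smooth_on_def by blast+
  then show "G differentiable (at p)" "continuous_on S G"
    by (auto simp: differentiable_on_def intro: continuous_on_subset)
qed

lemma quasilinear_system_at_0:
  assumes "quasilinear_system g f g2 g3 f2"
  shows "g \<alpha> \<beta> 0 = (if \<alpha> = \<beta> then (if \<alpha> = None then -1 else 1) else 0)" "f 0 = 0"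
proof -
  obtain \<rho> C where \<rho>: "\<rho> > 0" and *: "\<forall>\<xi> \<eta>. norm \<xi> < \<rho> \<and> norm \<eta> < \<rho> \<longrightarrow>
        (\<forall>\<alpha> \<beta>. \<bar>g \<alpha> \<beta> (\<xi>, \<eta>)
             - ((if \<alpha> = \<beta> then (if \<alpha> = None then -1 else 1) else 0)
                + (\<Sum>J\<in>UNIV. g2 J \<alpha> \<beta> * \<xi> $ J)
                + (\<Sum>J\<in>UNIV. \<Sum>\<nu>\<in>UNIV. g3 J \<alpha> \<beta> \<nu> * \<eta> $ \<nu> $ J))\<bar>
           \<le> C * ((norm \<xi>)\<^sup>2 + (norm \<eta>)\<^sup>2)) \<and>
        (\<forall>I. \<bar>f (\<xi>, \<eta>) $ I
             - (\<Sum>J\<in>UNIV. \<Sum>K\<in>UNIV. \<Sum>\<alpha>\<in>UNIV. \<Sum>\<beta>\<in>UNIV.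
                  f2 I J K \<alpha> \<beta> * \<eta> $ \<alpha> $ J * \<eta> $ \<beta> $ K)\<bar>
           \<le> C * (norm \<xi> ^ 4 + norm \<eta> * ((norm \<eta>)\<^sup>2 + (norm \<xi>)\<^sup>2)))"
    using assms unfolding quasilinear_system_def by blast
  from *[rule_format, of 0 0] \<rho>
  show "g \<alpha> \<beta> 0 = (if \<alpha> = \<beta> then (if \<alpha> = None then -1 else 1) else 0)" "f 0 = 0"
    by (simp_all add: zero_prod_def vec_eq_iff)
qed

text \<open>The constant depends on \<open>u\<close> and \<open>K\<close>: second derivatives of
  \<open>u\<close> are treated as known bounded coefficients of a linear inequality, which is enough
  for a statement about vanishing.\<close>

lemma QW_wave_op_bound:
  fixes u :: "spacetime \<Rightarrow> real^'m"
  assumes qs: "quasilinear_system g f g2 g3 f2" and sol: "QW_solution g f u"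
    and C2: "Ck_on 2 upper_half u" and K: "compact K" "K \<subseteq> upper_half"
  shows "\<exists>C. \<forall>z\<in>K. norm (wave_op u z) \<le> C * norm (u z, grad upper_half u z)"
proof -
  define P where "P z = (u z, grad upper_half u z)" for z
  define mm :: "st_index \<Rightarrow> st_index \<Rightarrow> real"
    where "mm \<alpha> \<beta> = (if \<alpha> = \<beta> then (if \<alpha> = None then -1 else 1) else 0)" for \<alpha> \<beta>
  define D where "D \<alpha> \<beta> = pd upper_half (st_axis \<alpha>) (pd upper_half (st_axis \<beta>) u)" for \<alpha> \<beta>
  have C2': "Ck_on (Suc (Suc 0)) upper_half u"
    using C2 by (simp only: numeral_2_eq_2)
  have "continuous_on upper_half (D \<alpha> \<beta>)" for \<alpha> \<beta>
    using C2' st_axis_in_Basis unfolding D_def by simp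
  then have cD: "continuous_on K (D \<alpha> \<beta>)" for \<alpha> \<beta>
    using K(2) continuous_on_subset by blast
  have "continuous_on upper_half u" "continuous_on upper_half (pd upper_half (st_axis \<alpha>) u)" for \<alpha>
    using C2' st_axis_in_Basis[of \<alpha>] by (auto intro: differentiable_imp_continuous_on)
  then have "continuous_on upper_half P"
    unfolding P_def grad_def by (intro continuous_intros)
  then have cP: "compact (P ` K)"
    using K by (meson compact_continuous_image continuous_on_subset)
  have sg: "smooth_on UNIV (g \<alpha> \<beta>)" and sf: "smooth_on UNIV f" for \<alpha> \<beta>
    using qs by (auto simp: quasilinear_system_def)
  note at_0 = quasilinear_system_at_0[OF qs]
  have "\<exists>C. \<forall>p\<in>P ` K. norm (g \<alpha> \<beta> p - mm \<alpha> \<beta>) \<le> C * norm p" for \<alpha> \<beta>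
    by (intro vanishing_at_0_linear_bound cP)
      (use smooth_on_UNIV_differentiable[OF sg] at_0 in \<open>auto simp: mm_def intro!: continuous_intros\<close>)
  note * = this
  obtain Cg where Cg: "\<And>\<alpha> \<beta> z. z \<in> K \<Longrightarrow> \<bar>g \<alpha> \<beta> (P z) - mm \<alpha> \<beta>\<bar> \<le> Cg \<alpha> \<beta> * norm (P z)"
  proof -
    have "\<exists>C. \<forall>z\<in>K. \<bar>g \<alpha> \<beta> (P z) - mm \<alpha> \<beta>\<bar> \<le> C * norm (P z)" for \<alpha> \<beta>
      using * by (simp add: real_norm_def)
    then show thesis using that by metis
  qed
  obtain Cf where Cf: "\<And>z. z \<in> K \<Longrightarrow> norm (f (P z)) \<le> Cf * norm (P z)"
    using vanishing_at_0_linear_bound[OF smooth_on_UNIV_differentiable[OF sf] at_0(2) cP] by blast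
  have "\<exists>b. \<forall>z\<in>K. norm (D \<alpha> \<beta> z) \<le> b" for \<alpha> \<beta>
    using compact_imp_bounded[OF compact_continuous_image[OF cD K(1)]] by (auto simp: bounded_iff)
  then obtain b where b: "\<And>\<alpha> \<beta> z. z \<in> K \<Longrightarrow> norm (D \<alpha> \<beta> z) \<le> b \<alpha> \<beta>" by metis
  have "norm (wave_op u z) \<le> (Cf + (\<Sum>\<alpha>\<in>UNIV. \<Sum>\<beta>\<in>UNIV. Cg \<alpha> \<beta> * b \<alpha> \<beta>)) * norm (P z)" if z: "z \<in> K" for z
  proof -
    have "(\<Sum>\<alpha>\<in>UNIV. \<Sum>\<beta>\<in>UNIV. g \<alpha> \<beta> (P z) *\<^sub>R D \<alpha> \<beta> z) = f (P z)"
      using sol z K(2) unfolding QW_solution_def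
      by (auto simp: vec_eq_iff P_def D_def)
    moreover have "(\<Sum>\<alpha>\<in>UNIV. \<Sum>\<beta>\<in>UNIV. mm \<alpha> \<beta> *\<^sub>R D \<alpha> \<beta> z) = wave_op u z"
    proof -
      have "(\<Sum>\<beta>\<in>UNIV. mm \<alpha> \<beta> *\<^sub>R D \<alpha> \<beta> z) = (if \<alpha> = None then -1 else 1) *\<^sub>R D \<alpha> \<alpha> z" for \<alpha>
        by (simp add: mm_def if_distrib[of "\<lambda>c. c *\<^sub>R _"] cong: if_cong)
      then show ?thesis by (simp add: sum_st_index wave_op_def D_def)
    qed
    ultimately have "wave_op u z = f (P z) - (\<Sum>\<alpha>\<in>UNIV. \<Sum>\<beta>\<in>UNIV. (g \<alpha> \<beta> (P z) - mm \<alpha> \<beta>) *\<^sub>R D \<alpha> \<beta> z)"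
      by (simp add: scaleR_diff_left sum_subtractf)
    also have "norm \<dots> \<le> norm (f (P z)) + norm (\<Sum>\<alpha>\<in>UNIV. \<Sum>\<beta>\<in>UNIV. (g \<alpha> \<beta> (P z) - mm \<alpha> \<beta>) *\<^sub>R D \<alpha> \<beta> z)"
      by (rule norm_triangle_ineq4)
    also have "\<dots> \<le> Cf * norm (P z) + (\<Sum>\<alpha>\<in>UNIV. \<Sum>\<beta>\<in>UNIV. Cg \<alpha> \<beta> * norm (P z) * b \<alpha> \<beta>)"
    proof (intro add_mono Cf[OF z] sum_norm_le)
      fix \<alpha> \<beta>
      show "norm ((g \<alpha> \<beta> (P z) - mm \<alpha> \<beta>) *\<^sub>R D \<alpha> \<beta> z) \<le> Cg \<alpha> \<beta> * norm (P z) * b \<alpha> \<beta>"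
        unfolding norm_scaleR
        by (intro mult_mono Cg b z order_trans[OF abs_ge_zero Cg[OF z]]) simp
    qed
    also have "\<dots> = (Cf + (\<Sum>\<alpha>\<in>UNIV. \<Sum>\<beta>\<in>UNIV. Cg \<alpha> \<beta> * b \<alpha> \<beta>)) * norm (P z)"
      by (simp add: algebra_simps sum_distrib_left)
    finally show ?thesis .
  qed
  then show ?thesis unfolding P_def by blast
qed

lemma QW_finite_speed:
  fixes u :: "spacetime \<Rightarrow> real^'m"
  assumes "quasilinear_system g f g2 g3 f2" "QW_solution g f u" "Ck_on 2 upper_half u"
    and "compact (data_support u)"
  shows "\<exists>R. \<forall>t\<ge>0. \<forall>x. norm x > R + t \<longrightarrow> u (t, x) = 0"
proof -
  obtain R where R: "\<And>x. x \<in> data_support u \<Longrightarrow> norm x \<le> R"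
    using compact_imp_bounded[OF assms(4)] by (auto simp: bounded_iff)
  have "u (0, x) = 0 \<and> d_t upper_half u (0, x) = 0" if "norm x > R" for x
    using R[of x] that closure_subset[of "{x. u (0, x) \<noteq> 0 \<or> d_t upper_half u (0, x) \<noteq> 0}"]
    unfolding data_support_def by auto
  then show ?thesis
    using wave_finite_speed[OF assms(3) QW_wave_op_bound[OF assms(1-3)]] by blast
qed

text \<open>Carries the vanishing of \<open>u\<close> outside a cone over to
  \<open>u_t - u_r\<close>.\<close>

lemma pd_eq_0_if_locally_0:
  assumes "z \<in> interior S" "open W" "z \<in> W" "\<And>y. y \<in> W \<Longrightarrow> y \<in> S \<Longrightarrow> u y = 0"
  shows "pd S v u z = 0"
proof -
  have "((\<lambda>y. 0) has_derivative (\<lambda>v. 0)) (at z)" by simp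
  then have "(u has_derivative (\<lambda>v. 0)) (at z)"
  proof (rule has_derivative_transform_within_open)
    show "open (W \<inter> interior S)" using assms by blast
  qed (use assms interior_subset in force)+
  moreover have "at z within S = at z" using assms(1) by (rule at_within_interior)
  ultimately show ?thesis
    unfolding pd_def using frechet_derivative_at by metis
qed

text \<open>On the ray through \<omega> the operator is a single derivative in the null direction
  \<open>(1, - \<omega>)\<close>; this makes the equation of the optical function an ordinary
  differential equation.\<close>

lemma d_t_minus_d_r:
  assumes "\<phi> differentiable_on S" "(t, r *\<^sub>R \<omega>) \<in> S" "r > 0" "norm \<omega> = 1"
  shows "d_t S \<phi> (t, r *\<^sub>R \<omega>) - d_r S \<phi> (t, r *\<^sub>R \<omega>) = pd S (1, - \<omega>) \<phi> (t, r *\<^sub>R \<omega>)"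
proof -
  let ?z = "(t, r *\<^sub>R \<omega>)"
  interpret L: linear "\<lambda>v. pd S v \<phi> ?z" using assms by (intro pd_linear_direction)
  have "(\<Sum>i\<in>UNIV. \<omega> $ i *\<^sub>R (axis i 1 :: real^3)) = \<omega>"
    by (simp add: basis_expansion flip: scalar_mult_eq_scaleR)
  then have "(1, - \<omega>) = st_axis None - (\<Sum>i\<in>UNIV. \<omega> $ i *\<^sub>R st_axis (Some i))"
    by (simp add: st_axis_def prod_eq_iff fst_sum snd_sum)
  then have "pd S (1, - \<omega>) \<phi> ?z = pd S (st_axis None) \<phi> ?z
      - (\<Sum>i\<in>UNIV. \<omega> $ i *\<^sub>R pd S (st_axis (Some i)) \<phi> ?z)"
    by (simp add: L.diff L.sum L.scale)
  then show ?thesis using assms by (simp add: d_t_def d_r_def)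
qed


section \<open>The optical function\<close>

lemma jb_ge_1: "jb z \<ge> 1" by (simp add: jb_def)

text \<open>\<open>jb z\<close> is the Euclidean norm of \<open>(1, z)\<close>, so the triangle
  inequality applies.\<close>

lemma jb_add_le: "jb (x + y) \<le> jb x + \<bar>y\<bar>"
proof -
  have "jb z = norm (1::real, z)" for z by (simp add: jb_def norm_Pair)
  moreover have "norm (1::real, x + y) \<le> norm (1::real, x) + norm (0::real, y)"
    using norm_triangle_ineq[of "(1::real, x)" "(0, y)"] by simp
  ultimately show ?thesis by (simp add: norm_Pair)
qed

lemma jb_le: "jb x \<le> 1 + \<bar>x\<bar>"
  using jb_add_le[of 0 x] by (simp add: jb_def)

text \<open>Substituting \<open>q = sinh y\<close> turns \<open>jb q powr (-1 - a) dq\<close> into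
  \<open>cosh y powr (- a) dy\<close>. This is comparable to the square of
  \<open>1 / cosh (a / 2 * y)\<close>, whose primitive is a multiple of
  \<open>tanh (a / 2 * y)\<close>. The constant \<open>c\<close> comes from
  \<open>exp \<bar>y\<bar> \<le> 2 * cosh y\<close>.\<close>

lemma bounded_primitive_of_jb_powr:
  fixes a :: real
  assumes "a > 0"
  obtains \<Psi> \<Psi>' c where "c > 0" "\<And>q. (\<Psi> has_real_derivative \<Psi>' q) (at q)"
    "\<And>q. \<bar>\<Psi> q\<bar> \<le> 1" "\<And>q. \<Psi>' q \<ge> c * jb q powr (-1 - a)"
proof
  let ?\<Psi> = "\<lambda>q. tanh (a / 2 * arsinh q)"
  let ?\<Psi>' = "\<lambda>q. (1 - (tanh (a / 2 * arsinh q))\<^sup>2) * (a / 2 * (1 / sqrt (q\<^sup>2 + 1)))"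
  show "(?\<Psi> has_real_derivative ?\<Psi>' q) (at q)" for q
    by (auto intro!: derivative_eq_intros simp: cosh_real_nonzero)
  show "\<bar>?\<Psi> q\<bar> \<le> 1" for q
    using tanh_real_lt_1[of "a / 2 * arsinh q"] tanh_real_gt_neg1[of "a / 2 * arsinh q"] by linarith
  show "a / 2 * 2 powr (- a) > 0" using assms by simp
  show "?\<Psi>' q \<ge> a / 2 * 2 powr (- a) * jb q powr (-1 - a)" for q
  proof -
    define y where "y = a / 2 * arsinh q"
    have jb: "jb q = cosh (arsinh q)" by (simp add: jb_def cosh_arsinh_real add.commute)
    have "exp \<bar>arsinh q\<bar> \<le> 2 * jb q"
      unfolding jb by (simp add: cosh_def abs_if)
    then have "(2 * jb q) powr (- a) \<le> exp \<bar>arsinh q\<bar> powr (- a)"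
      using assms by (intro powr_mono2') auto
    also have "\<dots> = (exp (- \<bar>y\<bar>))\<^sup>2"
      using assms by (simp add: powr_def y_def abs_mult flip: exp_of_nat_mult)
    also have "\<dots> \<le> (1 / cosh y)\<^sup>2"
    proof (rule power_mono)
      have "cosh y \<le> exp \<bar>y\<bar>" by (simp add: cosh_def abs_if)
      then show "exp (- \<bar>y\<bar>) \<le> 1 / cosh y"
        by (simp add: exp_minus field_simps cosh_real_pos)
    qed simp
    also have "(1 / cosh y)\<^sup>2 = ((cosh y)\<^sup>2 - (sinh y)\<^sup>2) / (cosh y)\<^sup>2"
      by (simp add: power_divide cosh_square_eq)
    also have "\<dots> = 1 - (tanh y)\<^sup>2"
      using cosh_real_pos[of y] by (simp add: tanh_def power_divide diff_divide_distrib)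
    finally have "2 powr (- a) * jb q powr (- a) \<le> 1 - (tanh y)\<^sup>2"
      using jb_ge_1[of q] by (simp add: powr_mult)
    then have "2 powr (- a) * jb q powr (- a) * (a / 2 * (1 / jb q)) \<le> (1 - (tanh y)\<^sup>2) * (a / 2 * (1 / jb q))"
      using assms jb_ge_1[of q] by (intro mult_right_mono) auto
    moreover have "jb q powr (-1 - a) = jb q powr (- a) * (1 / jb q)"
      using jb_ge_1[of q] by (simp add: powr_diff powr_minus field_simps)
    moreover have "jb q = sqrt (q\<^sup>2 + 1)" by (simp add: jb_def add.commute)
    ultimately show ?thesis by (simp add: y_def mult_ac)
  qed
qed

text \<open>An incoming line is followed from \<open>(t, r *\<^sub>R \<omega>)\<close> to the cone
  where time is twice the radius and \<open>q\<close> is prescribed. On the way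
  \<open>Q \<tau> + 2 * \<tau>\<close> changes by no more than the oscillation of
  \<open>L * \<Psi> (Q \<tau>)\<close>, which is at most \<open>2 * L\<close>.\<close>

lemma optical_function_near:
  assumes adm: "admissible g2 g3 \<gamma>p \<gamma>m \<delta>0 \<mu> U"
    and \<gamma>: "\<gamma>p > 1" "\<gamma>m > 1" and \<delta>: "0 < \<delta>" "\<delta> < \<delta>0" "\<delta>0 < 1"
  obtains K b where "K > 0" "b > 0"
    "\<And>\<epsilon> q t r \<omega>. \<lbrakk>0 < \<epsilon>; \<epsilon> < 1; optical_function \<delta> \<mu> \<epsilon> q; 1 / \<epsilon> \<le> t; t / 2 \<le> r; r \<le> 2 * t; norm \<omega> = 1\<rbrakk>
       \<Longrightarrow> \<bar>q (t, r *\<^sub>R \<omega>) - (r - t)\<bar> \<le> K * t powr (b * \<epsilon>)"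
proof -
  \<comment> \<open>With this \<open>a\<close> one integrable weight
    \<open>jb q powr (-1 - a)\<close> dominates the decay for both signs of
    \<open>q\<close>.\<close>
  define a where "a = min \<gamma>p \<gamma>m - 1"
  have a: "a > 0" using \<gamma> by (simp add: a_def)
  obtain \<Psi> \<Psi>' c where \<Psi>: "c > 0" "\<And>q. (\<Psi> has_real_derivative \<Psi>' q) (at q)"
    "\<And>q. \<bar>\<Psi> q\<bar> \<le> 1" "\<And>q. \<Psi>' q \<ge> c * jb q powr (-1 - a)"
    by (rule bounded_primitive_of_jb_powr[OF a]) blast
  have "\<exists>A>0. \<exists>B. \<forall>(s, q, \<omega>)\<in>profile_dom \<delta>0.
        - A * exp (B * s) \<le> \<mu> (s, q, \<omega>) \<and> \<mu> (s, q, \<omega>) \<le> - (1 / A) * exp (- B * s)"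
    using adm unfolding admissible_def Let_def by (rule conjunct1)
  then obtain A1 B1 where A1: "A1 > 0" and \<mu>1: "\<And>s q \<omega>. (s, q, \<omega>) \<in> profile_dom \<delta>0 \<Longrightarrow>
      \<mu> (s, q, \<omega>) \<le> - (1 / A1) * exp (- B1 * s)"
    by fast
  have "\<exists>A B. \<forall>(s, q, \<omega>)\<in>profile_dom \<delta>0.
        \<bar>d_sq\<omega> \<delta>0 0 0 [] (\<lambda>z. \<mu> z + 2) (s, q, \<omega>)\<bar>
          \<le> A * (exp (B * s) * jb q powr (- real 0 - (if q \<ge> 0 then \<gamma>p else \<gamma>m)))"
    using adm unfolding admissible_def Let_def by blast
  then obtain A2 B2 where \<mu>2: "\<And>s q \<omega>. (s, q, \<omega>) \<in> profile_dom \<delta>0 \<Longrightarrow>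
      \<bar>\<mu> (s, q, \<omega>) + 2\<bar> \<le> A2 * (exp (B2 * s) * jb q powr (- (if q \<ge> 0 then \<gamma>p else \<gamma>m)))"
    unfolding d_sq\<omega>_def by fastforce
  \<comment> \<open>The summand 1 ensures \<open>b > 0\<close>. The exponential in \<open>K0\<close>
    pays for the constant in \<open>\<bar>s\<bar> \<le> 2 + \<epsilon> * ln t\<close>, and
    \<open>A1\<close> enters through the lower bound for \<open>- \<mu>\<close>.\<close>
  define b where "b = \<bar>B1\<bar> + \<bar>B2\<bar> + 1"
  define K0 where "K0 = (\<bar>A2\<bar> + 1) * A1 / c * exp (2 * (\<bar>B1\<bar> + \<bar>B2\<bar>))"
  have K0: "K0 > 0" using A1 \<Psi>(1) by (simp add: K0_def)
  show thesis
  proof (rule that[of "2 * K0" b])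
    fix \<epsilon> q t r and \<omega> :: "real^3"
    assume \<epsilon>: "0 < \<epsilon>" "\<epsilon> < 1" and opt: "optical_function \<delta> \<mu> \<epsilon> q" and t: "1 / \<epsilon> \<le> t"
      and r: "t / 2 \<le> r" "r \<le> 2 * t" and \<omega>: "norm \<omega> = 1"
    have t1: "t > 1" using \<epsilon> t by (meson less_divide_eq_1_pos less_le_trans)
    \<comment> \<open>The solution of \<open>t + \<tau> = 2 * (r - \<tau>)\<close>, that is, the
      parameter at which the line meets the cone with prescribed \<open>q\<close>.\<close>
    define \<tau>1 where "\<tau>1 = (2 * r - t) / 3"
    have \<tau>1: "0 \<le> \<tau>1" "\<tau>1 \<le> t" "\<tau>1 < r" using r t1 by (auto simp: \<tau>1_def)
    define L where "L = K0 * t powr (b * \<epsilon>)"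
    have L: "L > 0" using K0 t1 by (simp add: L_def)
    define Q where "Q \<tau> = q (t + \<tau>, (r - \<tau>) *\<^sub>R \<omega>)" for \<tau>
    define mu where "mu \<tau> = \<mu> (\<epsilon> * ln (t + \<tau>) - \<delta>, Q \<tau>, \<omega>)" for \<tau>
    have line: "(t, r *\<^sub>R \<omega>) + \<tau> *\<^sub>R (1, - \<omega>) = (t + \<tau>, (r - \<tau>) *\<^sub>R \<omega>)" for \<tau>
      by (simp add: scaleR_left_diff_distrib)
    have ext: "(t + \<tau>, (r - \<tau>) *\<^sub>R \<omega>) \<in> exterior \<epsilon>" if "\<tau> \<in> {0..\<tau>1}" for \<tau>
    proof -
      have "norm ((r - \<tau>) *\<^sub>R \<omega>) = r - \<tau>" using that \<omega> \<tau>1 by simp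
      moreover have "r - \<tau> \<ge> (t + \<tau>) / 2" using that by (simp add: \<tau>1_def field_simps)
      moreover have "t + \<tau> \<ge> 1 / \<epsilon>" using that t by simp
      ultimately show ?thesis unfolding exterior_def by simp
    qed
    have dQ: "(Q has_real_derivative mu \<tau>) (at \<tau> within {0..\<tau>1})" if \<tau>: "\<tau> \<in> {0..\<tau>1}" for \<tau>
    proof -
      have "q differentiable_on exterior \<epsilon>" using opt by (simp add: optical_function_def)
      from pd_has_vector_derivative[OF this, of "(t, r *\<^sub>R \<omega>)" \<tau> "(1, - \<omega>)" "{0..\<tau>1}"]
      have "(Q has_real_derivative pd (exterior \<epsilon>) (1, - \<omega>) q (t + \<tau>, (r - \<tau>) *\<^sub>R \<omega>)) (at \<tau> within {0..\<tau>1})"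
        unfolding line has_real_derivative_iff_has_vector_derivative Q_def[abs_def] using ext \<tau> by blast
      also have "pd (exterior \<epsilon>) (1, - \<omega>) q (t + \<tau>, (r - \<tau>) *\<^sub>R \<omega>) = mu \<tau>"
      proof -
        have "pd (exterior \<epsilon>) (1, - \<omega>) q (t + \<tau>, (r - \<tau>) *\<^sub>R \<omega>)
            = in_coords \<delta> \<epsilon> q \<mu> (t + \<tau>, (r - \<tau>) *\<^sub>R \<omega>)"
          using d_t_minus_d_r[OF \<open>q differentiable_on _\<close> ext[OF \<tau>]] \<tau> \<tau>1 \<omega> opt ext[OF \<tau>]
          by (auto simp: optical_function_def)
        then show ?thesis
          using \<tau> \<tau>1 \<omega> by (simp add: in_coords_def mu_def Q_def sgn_div_norm)
      qed
      finally show ?thesis .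
    qed
    \<comment> \<open>Multiplication by a bound of 1 in terms of \<open>- mu \<tau>\<close> inserts
      the Jacobian: \<open>\<Psi>' (Q \<tau>) * (- mu \<tau>)\<close> is minus the derivative of
      \<open>\<Psi> (Q \<tau>)\<close>.\<close>
    have key: "\<bar>mu \<tau> + 2\<bar> \<le> L * \<Psi>' (Q \<tau>) * (- mu \<tau>)" if \<tau>: "\<tau> \<in> {0..\<tau>1}" for \<tau>
    proof -
      define s where "s = \<epsilon> * ln (t + \<tau>) - \<delta>"
      have "ln (t + \<tau>) \<le> ln (2 * t)" using \<tau> \<tau>1 t1 by simp
      also have "\<dots> \<le> 1 + ln t" using t1 ln_2_less_1 by (simp add: ln_mult)
      finally have "\<epsilon> * ln (t + \<tau>) \<le> \<epsilon> * (1 + ln t)" using \<epsilon> by (intro mult_left_mono) auto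
      also have "\<dots> \<le> 1 + \<epsilon> * ln t" using \<epsilon> by (simp add: algebra_simps)
      finally have 1: "\<epsilon> * ln (t + \<tau>) \<le> 1 + \<epsilon> * ln t" .
      have 0: "0 \<le> \<epsilon> * ln (t + \<tau>)" using \<epsilon> \<tau> t1 by simp
      have s: "\<bar>s\<bar> \<le> 2 + \<epsilon> * ln t" "s \<ge> - \<delta>0" using 0 1 \<delta> by (auto simp: s_def)
      have dom: "(s, Q \<tau>, \<omega>) \<in> profile_dom \<delta>0" using s \<omega> by (simp add: profile_dom_def)
      have E: "exp (B * s) \<le> exp (2 * \<bar>B\<bar>) * t powr (\<bar>B\<bar> * \<epsilon>)" for B
      proof -
        have "B * s \<le> \<bar>B\<bar> * \<bar>s\<bar>" by (metis abs_ge_self abs_mult)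
        also have "\<dots> \<le> \<bar>B\<bar> * (2 + \<epsilon> * ln t)" using s by (intro mult_left_mono) auto
        finally show ?thesis using t1 by (simp add: powr_def algebra_simps flip: exp_add)
      qed
      let ?J = "jb (Q \<tau>) powr (-1 - a)"
      have "jb (Q \<tau>) powr (- (if Q \<tau> \<ge> 0 then \<gamma>p else \<gamma>m)) \<le> ?J"
        using jb_ge_1 by (intro powr_mono) (auto simp: a_def)
      then have "\<bar>mu \<tau> + 2\<bar> \<le> (\<bar>A2\<bar> + 1) * (exp (B2 * s) * ?J)"
        unfolding mu_def s_def[symmetric]
        by (intro order_trans[OF \<mu>2[OF dom]] mult_mono) auto
      also have "\<dots> \<le> (\<bar>A2\<bar> + 1) * (exp (2 * \<bar>B2\<bar>) * t powr (\<bar>B2\<bar> * \<epsilon>) * ?J)"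
        by (intro mult_left_mono mult_right_mono E) auto
      also have "\<dots> = ((\<bar>A2\<bar> + 1) * exp (2 * \<bar>B2\<bar>) * t powr (\<bar>B2\<bar> * \<epsilon>) * ?J) * 1" by simp
      also have "\<dots> \<le> ((\<bar>A2\<bar> + 1) * exp (2 * \<bar>B2\<bar>) * t powr (\<bar>B2\<bar> * \<epsilon>) * ?J)
          * (A1 * (exp (2 * \<bar>B1\<bar>) * t powr (\<bar>B1\<bar> * \<epsilon>)) * (- mu \<tau>))"
      proof (rule mult_left_mono)
        have "1 = exp (B1 * s) * exp (- B1 * s)" by (simp flip: exp_add)
        also have "\<dots> \<le> exp (B1 * s) * (A1 * (- mu \<tau>))"
        proof (rule mult_left_mono)
          have "mu \<tau> \<le> - (1 / A1) * exp (- B1 * s)"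
            unfolding mu_def s_def[symmetric] by (rule \<mu>1[OF dom])
          then show "exp (- B1 * s) \<le> A1 * (- mu \<tau>)" using A1 by (simp add: field_simps)
        qed simp
        also have "\<dots> \<le> exp (2 * \<bar>B1\<bar>) * t powr (\<bar>B1\<bar> * \<epsilon>) * (A1 * (- mu \<tau>))"
        proof (rule mult_right_mono[OF E])
          have "mu \<tau> \<le> - (1 / A1) * exp (- B1 * s)"
            unfolding mu_def s_def[symmetric] by (rule \<mu>1[OF dom])
          also have "\<dots> \<le> 0" using A1 by simp
          finally show "0 \<le> A1 * (- mu \<tau>)" using A1 by (intro mult_nonneg_nonneg) auto
        qed
        finally show "1 \<le> A1 * (exp (2 * \<bar>B1\<bar>) * t powr (\<bar>B1\<bar> * \<epsilon>)) * (- mu \<tau>)"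
          by (simp add: mult_ac)
      qed simp
      also have "\<dots> = K0 * t powr ((\<bar>B1\<bar> + \<bar>B2\<bar>) * \<epsilon>) * (c * ?J) * (- mu \<tau>)"
      proof -
        have "X * e2 * p2 * j * (A1 * (e1 * p1) * m) = X * A1 / c * (e1 * e2) * (p1 * p2) * (c * j) * m"
          for X e1 e2 p1 p2 j m
          using \<Psi>(1) by (simp add: field_simps)
        then show ?thesis unfolding K0_def exp_add powr_add distrib_left distrib_right[of "\<bar>B1\<bar>"] .
      qed
      also have "\<dots> \<le> L * \<Psi>' (Q \<tau>) * (- mu \<tau>)"
      proof (rule mult_right_mono)
        have "t powr ((\<bar>B1\<bar> + \<bar>B2\<bar>) * \<epsilon>) \<le> t powr (b * \<epsilon>)"
          using t1 \<epsilon> by (intro powr_mono) (auto simp: b_def)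
        then show "K0 * t powr ((\<bar>B1\<bar> + \<bar>B2\<bar>) * \<epsilon>) * (c * ?J) \<le> L * \<Psi>' (Q \<tau>)"
          unfolding L_def using K0 \<Psi>(1) by (intro mult_mono \<Psi>(4)) auto
        have "mu \<tau> \<le> - (1 / A1) * exp (- B1 * s)"
          unfolding mu_def s_def[symmetric] by (rule \<mu>1[OF dom])
        also have "\<dots> \<le> 0" using A1 by simp
        finally show "0 \<le> - mu \<tau>" by simp
      qed
      finally show ?thesis .
    qed
    have dV: "((\<lambda>\<tau>. \<Psi> (Q \<tau>)) has_real_derivative \<Psi>' (Q \<tau>) * mu \<tau>) (at \<tau> within {0..\<tau>1})"
      if "\<tau> \<in> {0..\<tau>1}" for \<tau>
      using DERIV_chain2[OF \<Psi>(2) dQ[OF that]] .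
    \<comment> \<open>Adding \<open>L * \<Psi> (Q \<tau>)\<close> makes both
      \<open>Q \<tau> + 2 * \<tau>\<close> and its negative nonincreasing; these are the two sides
      of the estimate.\<close>
    have mono: "Q 0 + 2 * 0 + k * \<Psi> (Q 0) \<ge> Q \<tau>1 + 2 * \<tau>1 + k * \<Psi> (Q \<tau>1)" if "k = L" for k
    proof (rule DERIV_nonpos_imp_decreasing_open[OF \<tau>1(1)])
      have D: "((\<lambda>\<tau>. Q \<tau> + 2 * \<tau> + k * \<Psi> (Q \<tau>)) has_real_derivative
        mu \<tau> + 2 + k * (\<Psi>' (Q \<tau>) * mu \<tau>)) (at \<tau> within {0..\<tau>1})" if "\<tau> \<in> {0..\<tau>1}" for \<tau>
        by (auto intro!: derivative_eq_intros dQ[OF that] dV[OF that])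
      show "continuous_on {0..\<tau>1} (\<lambda>\<tau>. Q \<tau> + 2 * \<tau> + k * \<Psi> (Q \<tau>))"
        by (rule DERIV_continuous_on[OF D])
      fix \<tau> assume \<tau>: "0 < \<tau>" "\<tau> < \<tau>1"
      then show "\<exists>y. ((\<lambda>\<tau>. Q \<tau> + 2 * \<tau> + k * \<Psi> (Q \<tau>)) has_real_derivative y) (at \<tau>) \<and> y \<le> 0"
        using D[of \<tau>] key[of \<tau>] at_within_Icc_at[of 0 \<tau> \<tau>1] that
        by (intro exI[of _ "mu \<tau> + 2 + k * (\<Psi>' (Q \<tau>) * mu \<tau>)"]) auto
    qed
    have mono': "- (Q 0 + 2 * 0) + k * \<Psi> (Q 0) \<ge> - (Q \<tau>1 + 2 * \<tau>1) + k * \<Psi> (Q \<tau>1)" if "k = L" for k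
    proof (rule DERIV_nonpos_imp_decreasing_open[OF \<tau>1(1)])
      have D: "((\<lambda>\<tau>. - (Q \<tau> + 2 * \<tau>) + k * \<Psi> (Q \<tau>)) has_real_derivative
        - (mu \<tau> + 2) + k * (\<Psi>' (Q \<tau>) * mu \<tau>)) (at \<tau> within {0..\<tau>1})" if "\<tau> \<in> {0..\<tau>1}" for \<tau>
        by (auto intro!: derivative_eq_intros dQ[OF that] dV[OF that])
      show "continuous_on {0..\<tau>1} (\<lambda>\<tau>. - (Q \<tau> + 2 * \<tau>) + k * \<Psi> (Q \<tau>))"
        by (rule DERIV_continuous_on[OF D])
      fix \<tau> assume \<tau>: "0 < \<tau>" "\<tau> < \<tau>1"
      then show "\<exists>y. ((\<lambda>\<tau>. - (Q \<tau> + 2 * \<tau>) + k * \<Psi> (Q \<tau>)) has_real_derivative y) (at \<tau>) \<and> y \<le> 0"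
        using D[of \<tau>] key[of \<tau>] at_within_Icc_at[of 0 \<tau> \<tau>1] that
        by (intro exI[of _ "- (mu \<tau> + 2) + k * (\<Psi>' (Q \<tau>) * mu \<tau>)"]) auto
    qed
    have "L * \<Psi> (Q 0) - L * \<Psi> (Q \<tau>1) \<le> 2 * L"
      using mult_left_mono[of "\<Psi> (Q 0) - \<Psi> (Q \<tau>1)" 2 L] L \<Psi>(3)[of "Q 0"] \<Psi>(3)[of "Q \<tau>1"]
      by (simp add: algebra_simps abs_le_iff)
    then have "\<bar>Q 0 - (Q \<tau>1 + 2 * \<tau>1)\<bar> \<le> 2 * L"
      using mono[OF refl] mono'[OF refl] by (simp add: abs_le_iff)
    moreover have "Q \<tau>1 = - (r - \<tau>1)"
    proof -
      have "t + \<tau>1 = 2 * norm ((r - \<tau>1) *\<^sub>R \<omega>)" using \<omega> \<tau>1 by (simp add: \<tau>1_def field_simps)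
      then have "Q \<tau>1 = - norm ((r - \<tau>1) *\<^sub>R \<omega>)"
        using opt ext[of \<tau>1] \<tau>1 unfolding optical_function_def Q_def by fastforce
      then show ?thesis using \<tau>1 \<omega> by simp
    qed
    then have "Q \<tau>1 + 2 * \<tau>1 = r - t" by (simp add: \<tau>1_def field_simps)
    ultimately show "\<bar>q (t, r *\<^sub>R \<omega>) - (r - t)\<bar> \<le> 2 * K0 * t powr (b * \<epsilon>)"
      by (simp add: Q_def L_def)
  qed (use K0 in \<open>auto simp: b_def\<close>)
qed


section \<open>Lower bounds from matching\<close>

text \<open>The pointwise estimates for the empty product of vector fields. Trading the decay for
  \<open>r < t\<close> against the growth allowed for \<open>r \<ge> t\<close> leaves one power of
  \<open>jb (r - t)\<close> on both sides of the light cone; \<open>r \<le> 3 / 2 * t\<close>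
  excludes the region \<open>r > 2 * t\<close>.\<close>

lemma matches_pointwise:
  assumes m: "matches_with C N \<gamma>1 \<delta>0 \<delta> \<mu> U \<epsilon> q u"
    and C: "C > 0" and \<gamma>1: "\<gamma>1 > 2" and \<epsilon>: "0 < \<epsilon>" and t: "1 / \<epsilon> \<le> t"
    and r: "t / 2 \<le> r" "r \<le> 3 / 2 * t" and \<omega>: "norm \<omega> = 1"
  shows "norm (u (t, r *\<^sub>R \<omega>) - (\<epsilon> / r) *\<^sub>R U (\<epsilon> * ln t - \<delta>, q (t, r *\<^sub>R \<omega>), \<omega>))
      \<le> C * \<epsilon> * t powr (-3/2 + C * \<epsilon>) * jb (r - t) powr (1/2)"
    and "norm (d_t upper_half u (t, r *\<^sub>R \<omega>) - d_r upper_half u (t, r *\<^sub>R \<omega>)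
      - (\<epsilon> / r) *\<^sub>R muUq \<delta>0 \<mu> U (\<epsilon> * ln t - \<delta>, q (t, r *\<^sub>R \<omega>), \<omega>))
      \<le> C * \<epsilon> * t powr (-3/2 + C * \<epsilon>) * jb (r - t) powr (-1/2)"
proof -
  define x where "x = r *\<^sub>R \<omega>"
  have t0: "t > 0" using \<epsilon> t by (meson less_le_trans zero_less_divide_1_iff)
  have r0: "r > 0" using t0 r by simp
  have nx: "norm x = r" and sx: "sgn x = \<omega>" using r0 \<omega> by (simp_all add: x_def sgn_div_norm)
  have near: "x \<in> {x. 1/2 \<le> norm x / t \<and> norm x / t \<le> 3/2}"
    using nx r t0 by (simp add: field_simps)
  have tp: "t powr (-1/2 + C * \<epsilon>) * t powr (-1) = t powr (-3/2 + C * \<epsilon>)"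
    by (subst powr_add[symmetric]) simp
  have jm: "jb (r - t) powr (- (\<gamma>1 - 1) / 2) \<le> jb (r - t) powr (1/2)"
    using jb_ge_1 \<gamma>1 by (intro powr_mono) auto
  have "norm (u (t, x) - (\<epsilon> / r) *\<^sub>R U (\<epsilon> * ln t - \<delta>, q (t, x), \<omega>))
     \<le> C * \<epsilon> * t powr (-1/2 + C * \<epsilon>) *
            (t powr (-1) * jb (r - t) powr (- (\<gamma>1 - 1) / 2) * of_bool (r < t)
             + t powr (-1) * jb (r - t) powr (1/2) * of_bool (t \<le> r \<and> r \<le> 2 * t)
             + r powr (-1/2) * of_bool (r > 2 * t))"
    using m[unfolded matches_with_def Let_def, THEN conjunct1, THEN spec[where x="[]"], THEN mp, 
      THEN conjunct2, THEN conjunct2, THEN conjunct2, THEN spec[where x=t], THEN mp, THEN spec[where x="x"]]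
      near t by (simp add: Zprod_def nx sx in_coords_def)
  also have "\<dots> \<le> C * \<epsilon> * t powr (-1/2 + C * \<epsilon>) * (t powr (-1) * jb (r - t) powr (1/2))"
    using C \<epsilon> jm r t0 by (intro mult_left_mono) (auto simp: of_bool_def intro: divide_right_mono)
  also have "\<dots> = C * \<epsilon> * (t powr (-1/2 + C * \<epsilon>) * t powr (-1)) * jb (r - t) powr (1/2)"
    by (simp only: mult_ac)
  finally show "norm (u (t, r *\<^sub>R \<omega>) - (\<epsilon> / r) *\<^sub>R U (\<epsilon> * ln t - \<delta>, q (t, r *\<^sub>R \<omega>), \<omega>))
      \<le> C * \<epsilon> * t powr (-3/2 + C * \<epsilon>) * jb (r - t) powr (1/2)"
    unfolding tp x_def .
  have w0: "w0 \<gamma>1 t r powr (-1/2) \<le> 1"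
  proof -
    have "w0 \<gamma>1 t r \<ge> 1" using \<gamma>1 jb_ge_1 by (simp add: w0_def ge_one_powr_ge_zero)
    then show ?thesis using powr_mono[of "-1/2" 0 "w0 \<gamma>1 t r"] by simp
  qed
  have "norm (d_t upper_half u (t, x) - d_r upper_half u (t, x)
      - (\<epsilon> / r) *\<^sub>R muUq \<delta>0 \<mu> U (\<epsilon> * ln t - \<delta>, q (t, x), \<omega>))
      \<le> C * \<epsilon> * t powr (-3/2 + C * \<epsilon>) * jb (t - r) powr (-1/2) * w0 \<gamma>1 t r powr (-1/2)"
    using m[unfolded matches_with_def Let_def, THEN conjunct2, THEN spec[where x=t], THEN mp,
      THEN bspec[where x="x"]] near t by (simp add: nx sx in_coords_def)
  also have "\<dots> \<le> C * \<epsilon> * t powr (-3/2 + C * \<epsilon>) * jb (t - r) powr (-1/2) * 1"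
    using C \<epsilon> w0 by (intro mult_left_mono) auto
  also have "jb (t - r) = jb (r - t)" by (simp add: jb_def abs_minus_commute)
  finally show "norm (d_t upper_half u (t, r *\<^sub>R \<omega>) - d_r upper_half u (t, r *\<^sub>R \<omega>)
      - (\<epsilon> / r) *\<^sub>R muUq \<delta>0 \<mu> U (\<epsilon> * ln t - \<delta>, q (t, r *\<^sub>R \<omega>), \<omega>))
      \<le> C * \<epsilon> * t powr (-3/2 + C * \<epsilon>) * jb (r - t) powr (-1/2)"
    by (simp add: x_def)
qed

text \<open>
  The decay exponents of the profile and of the matching error are compared through
  \<open>p = 1/2\<close> for \<open>u\<close> and \<open>p = -1/2\<close> for \<open>u_t - u_r\<close>.
\<close>

lemma lower_bound_of_approximation:
  fixes K b C \<kappa> p lam C1 \<delta> M :: real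
  assumes K: "K > 0" and b: "b > 0" and C: "C > 0" and \<kappa>: "\<kappa> \<ge> 0" "\<kappa> + p \<ge> 0"
    and lam: "0 < lam" "lam < 1" "lam * (\<kappa> + p) < 1/2"
    and C1: "C1 > 0" and \<delta>: "\<delta> > 0" and M: "M > 0"
  obtains \<epsilon>0 where "\<epsilon>0 > 0"
    "\<And>\<epsilon> t r Q (V :: 'a::real_normed_vector) W.
      \<lbrakk>0 < \<epsilon>; \<epsilon> < \<epsilon>0; exp (1 / \<epsilon>) \<le> t; \<bar>r - t\<bar> < t powr lam; \<bar>Q - (r - t)\<bar> \<le> K * t powr (b * \<epsilon>);
       norm (V - (\<epsilon> / r) *\<^sub>R W) \<le> C * \<epsilon> * t powr (-3/2 + C * \<epsilon>) * jb (r - t) powr p;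
       norm W \<ge> M * jb Q powr (- \<kappa>) * exp (- C1 * (\<epsilon> * ln t - \<delta>))\<rbrakk>
      \<Longrightarrow> norm V \<ge> (1 + K) powr (- \<kappa>) / 4 * M * \<epsilon> * t powr (-1 - (b * \<kappa> + C1) * \<epsilon>) * jb (r - t) powr (- \<kappa>)"
    "\<And>\<epsilon> t. \<lbrakk>0 < \<epsilon>; \<epsilon> < \<epsilon>0; exp (1 / \<epsilon>) \<le> t\<rbrakk> \<Longrightarrow> t powr lam \<le> t / 2"
proof -
  \<comment> \<open>Up to powers of \<open>t\<close> with exponent \<open>O(\<epsilon>)\<close>,
    error over main term is of order \<open>t powr (-1/2) * jb (r - t) powr \<theta>\<close>, hence
    at most of order \<open>t powr (- \<eta>)\<close> where
    \<open>\<bar>r - t\<bar> < t powr lam\<close>. \<open>R\<close> collects the small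
    rates.\<close>
  define \<theta> where "\<theta> = \<kappa> + p"
  define \<eta> where "\<eta> = 1/2 - lam * \<theta>"
  define c where "c = (1 + K) powr (- \<kappa>) / 4"
  define R where "R = C + (b * \<kappa> + C1)"
  \<comment> \<open>The entries serve in turn: \<open>t powr lam \<le> t / 2\<close>; small rates
    that consume at most half of \<eta>; an error below half of the main term, which is where
    \<open>M\<close> enters.\<close>
  define \<epsilon>0 where "\<epsilon>0 = min (1 - lam) (min (\<eta> / (2 * R)) (c * M * \<eta> / (2 * C * 2 powr \<theta>)))"
  have \<eta>: "\<eta> > 0" using lam by (simp add: \<eta>_def \<theta>_def)
  have c: "c > 0" using K by (simp add: c_def)
  have R: "R > 0" using C C1 b \<kappa> by (simp add: R_def add_pos_nonneg)
  have half: "t powr lam \<le> t / 2" if "0 < \<epsilon>" "\<epsilon> < \<epsilon>0" "exp (1 / \<epsilon>) \<le> t" for \<epsilon> t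
  proof -
    have t0: "t > 0" using that(3) by (meson exp_gt_zero less_le_trans)
    have "1 / \<epsilon> \<le> ln t" using that(3) t0 by (simp add: ln_ge_iff)
    then have "1 \<le> \<epsilon> * ln t" using that(1) by (simp add: field_simps)
    also have "\<dots> \<le> (1 - lam) * ln t"
      using that \<open>1 / \<epsilon> \<le> ln t\<close> by (intro mult_right_mono) (auto simp: \<epsilon>0_def intro: order_trans[of 0 "1 / \<epsilon>"])
    finally have "ln 2 \<le> (1 - lam) * ln t" using ln_2_less_1 by linarith
    then have "ln (t powr lam) \<le> ln (t / 2)" using t0 by (simp add: ln_powr ln_div algebra_simps)
    then show ?thesis by (subst (asm) ln_le_cancel_iff) (use t0 in auto)
  qed
  show thesis
  proof (rule that[of \<epsilon>0])
    show "\<epsilon>0 > 0" using \<eta> R c M C lam by (simp add: \<epsilon>0_def)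
    show "t powr lam \<le> t / 2" if "0 < \<epsilon>" "\<epsilon> < \<epsilon>0" "exp (1 / \<epsilon>) \<le> t" for \<epsilon> t
      using half that .
    fix \<epsilon> t r Q and V W :: 'a
    assume \<epsilon>: "0 < \<epsilon>" "\<epsilon> < \<epsilon>0" and t: "exp (1 / \<epsilon>) \<le> t" and r: "\<bar>r - t\<bar> < t powr lam"
      and Q: "\<bar>Q - (r - t)\<bar> \<le> K * t powr (b * \<epsilon>)"
      and V: "norm (V - (\<epsilon> / r) *\<^sub>R W) \<le> C * \<epsilon> * t powr (-3/2 + C * \<epsilon>) * jb (r - t) powr p"
      and W: "norm W \<ge> M * jb Q powr (- \<kappa>) * exp (- C1 * (\<epsilon> * ln t - \<delta>))"
    define J where "J = jb (r - t)"
    have J: "J \<ge> 1" by (simp add: J_def jb_ge_1)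
    have t1: "t > 1" using t \<epsilon>(1) by (meson less_le_trans one_less_exp_iff zero_less_divide_1_iff)
    have r0: "r > 0" "r \<le> 2 * t" using half[OF \<epsilon> t] r t1 by auto
    \<comment> \<open>The sum becomes a product because \<open>J\<close> and
      \<open>t powr (b * \<epsilon>)\<close> are at least 1. This is the source of
      \<open>(1 + K) powr (- \<kappa>)\<close> and of the rate \<open>b * \<kappa>\<close>.\<close>
    have "jb Q \<le> J + \<bar>Q - (r - t)\<bar>"
      using jb_add_le[of "r - t" "Q - (r - t)"] by (simp add: J_def)
    also have "\<dots> \<le> J * t powr (b * \<epsilon>) + K * (J * t powr (b * \<epsilon>))"
    proof (rule add_mono)
      have "1 \<le> t powr (b * \<epsilon>)" using t1 b \<epsilon> by (simp add: ge_one_powr_ge_zero)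
      then show "J \<le> J * t powr (b * \<epsilon>)" using J by simp
      have "K * t powr (b * \<epsilon>) * 1 \<le> K * t powr (b * \<epsilon>) * J" using J K by (intro mult_left_mono) auto
      then show "\<bar>Q - (r - t)\<bar> \<le> K * (J * t powr (b * \<epsilon>))" using Q by (simp add: mult_ac)
    qed
    finally have "jb Q \<le> (1 + K) * t powr (b * \<epsilon>) * J" by (simp add: algebra_simps)
    then have "((1 + K) * t powr (b * \<epsilon>) * J) powr (- \<kappa>) \<le> jb Q powr (- \<kappa>)"
      using \<kappa> jb_ge_1[of Q] by (intro powr_mono2') auto
    then have Q\<kappa>: "4 * c * t powr (- (b * \<kappa> * \<epsilon>)) * J powr (- \<kappa>) \<le> jb Q powr (- \<kappa>)"
      using K J t1 by (simp add: powr_mult powr_powr c_def mult_ac)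
    have "t powr (- (C1 * \<epsilon>)) = exp (- C1 * (\<epsilon> * ln t))"
      using t1 by (simp add: powr_def mult_ac)
    also have "\<dots> \<le> exp (- C1 * (\<epsilon> * ln t - \<delta>))"
      using C1 \<delta> by (simp add: algebra_simps)
    finally have e: "t powr (- (C1 * \<epsilon>)) \<le> exp (- C1 * (\<epsilon> * ln t - \<delta>))" .
    \<comment> \<open>Of the 4 in \<open>c\<close>, one factor 2 comes from
      \<open>r \<le> 2 * t\<close>; the other leaves half of the main term to absorb the
      error.\<close>
    let ?A = "c * M * \<epsilon> * t powr (-1 - (b * \<kappa> + C1) * \<epsilon>) * J powr (- \<kappa>)"
    have "2 * ?A = \<epsilon> / (2 * t) * (M * (4 * c * t powr (- (b * \<kappa> * \<epsilon>)) * J powr (- \<kappa>)) * t powr (- (C1 * \<epsilon>)))"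
    proof -
      have "-1 - (b * \<kappa> + C1) * \<epsilon> = -1 + - (b * \<kappa> * \<epsilon>) + - (C1 * \<epsilon>)" by (simp add: algebra_simps)
      then have "t powr (-1 - (b * \<kappa> + C1) * \<epsilon>) = t powr (- (b * \<kappa> * \<epsilon>)) * t powr (- (C1 * \<epsilon>)) / t"
        using t1 by (simp only: powr_add) (simp add: powr_minus field_simps)
      then show ?thesis using t1 by (simp add: field_simps)
    qed
    also have "\<dots> \<le> \<epsilon> / r * (M * jb Q powr (- \<kappa>) * exp (- C1 * (\<epsilon> * ln t - \<delta>)))"
      using \<epsilon> M c r0 Q\<kappa> e by (intro mult_mono divide_left_mono) auto
    also have "\<dots> \<le> \<epsilon> / r * norm W" using W \<epsilon> r0 by (intro mult_left_mono) auto
    also have "\<dots> = norm ((\<epsilon> / r) *\<^sub>R W)" using \<epsilon> r0 by simp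
    also have "\<dots> \<le> norm V + norm (V - (\<epsilon> / r) *\<^sub>R W)"
      by (metis norm_minus_commute norm_triangle_sub)
    finally have 1: "2 * ?A \<le> norm V + C * \<epsilon> * t powr (-3/2 + C * \<epsilon>) * J powr p"
      using V by (simp add: J_def)
    \<comment> \<open>Half of \<eta> pays for the small rates. The other half, with
      \<open>t \<ge> exp (1 / \<epsilon>)\<close>, gives an exponentially small factor, which is at
      most \<open>2 * \<epsilon> / \<eta>\<close>.\<close>
    have "C * t powr (- \<eta> + R * \<epsilon>) * 2 powr \<theta> \<le> c * M"
    proof -
      have "R * \<epsilon> \<le> \<eta> / 2" using \<epsilon> R by (simp add: \<epsilon>0_def field_simps)
      then have "t powr (- \<eta> + R * \<epsilon>) \<le> t powr (- \<eta> / 2)" using t1 by (intro powr_mono) auto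
      also have "\<dots> \<le> exp (1 / \<epsilon>) powr (- \<eta> / 2)" using t \<eta> by (intro powr_mono2') auto
      also have "\<dots> = 1 / exp (\<eta> / (2 * \<epsilon>))" by (simp add: powr_def exp_minus field_simps)
      also have "\<dots> \<le> 1 / (\<eta> / (2 * \<epsilon>))"
      proof (rule divide_left_mono)
        show "\<eta> / (2 * \<epsilon>) \<le> exp (\<eta> / (2 * \<epsilon>))"
          using exp_ge_add_one_self[of "\<eta> / (2 * \<epsilon>)"] by linarith
      qed (use \<eta> \<epsilon> in auto)
      finally have "C * t powr (- \<eta> + R * \<epsilon>) * 2 powr \<theta> \<le> C * (2 * \<epsilon> / \<eta>) * 2 powr \<theta>"
        using C by (intro mult_left_mono mult_right_mono) auto
      also have "\<dots> \<le> c * M"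
      proof -
        have "\<epsilon> \<le> c * M * \<eta> / (2 * C * 2 powr \<theta>)" using \<epsilon> by (simp add: \<epsilon>0_def)
        then show ?thesis using C \<eta> by (simp add: field_simps)
      qed
      finally show ?thesis .
    qed
    have "J \<le> 1 + \<bar>r - t\<bar>" unfolding J_def by (rule jb_le)
    also have "\<dots> \<le> 2 * t powr lam" using r t1 lam ge_one_powr_ge_zero[of t lam] by simp
    finally have "J powr \<theta> \<le> (2 * t powr lam) powr \<theta>"
      using J \<kappa> by (intro powr_mono2) (auto simp: \<theta>_def)
    also have "\<dots> = 2 powr \<theta> * t powr (lam * \<theta>)" by (simp add: powr_mult powr_powr)
    finally have J\<theta>: "J powr \<theta> \<le> 2 powr \<theta> * t powr (lam * \<theta>)" .
    have "C * \<epsilon> * t powr (-3/2 + C * \<epsilon>) * J powr p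
        = C * \<epsilon> * t powr (-3/2 + C * \<epsilon>) * (J powr \<theta> * J powr (- \<kappa>))"
      by (simp add: \<theta>_def flip: powr_add)
    also have "\<dots> \<le> C * \<epsilon> * t powr (-3/2 + C * \<epsilon>) * (2 powr \<theta> * t powr (lam * \<theta>) * J powr (- \<kappa>))"
      using C \<epsilon> by (intro mult_left_mono mult_right_mono J\<theta>) auto
    also have "\<dots> = (C * t powr (- \<eta> + R * \<epsilon>) * 2 powr \<theta>) * (\<epsilon> * t powr (-1 - (b * \<kappa> + C1) * \<epsilon>) * J powr (- \<kappa>))"
    proof -
      have "t powr (-3/2 + C * \<epsilon>) * t powr (lam * \<theta>)
          = t powr (- \<eta> + R * \<epsilon>) * t powr (-1 - (b * \<kappa> + C1) * \<epsilon>)"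
        unfolding powr_add[symmetric] by (simp add: \<eta>_def R_def algebra_simps)
      then show ?thesis by (simp add: mult_ac) 
    qed
    also have "\<dots> \<le> (c * M) * (\<epsilon> * t powr (-1 - (b * \<kappa> + C1) * \<epsilon>) * J powr (- \<kappa>))"
      using \<open>_ \<le> c * M\<close> \<epsilon> by (intro mult_right_mono) auto
    finally have "norm V \<ge> ?A" using 1 by simp
    then show "norm V \<ge> (1 + K) powr (- \<kappa>) / 4 * M * \<epsilon> * t powr (-1 - (b * \<kappa> + C1) * \<epsilon>) * jb (r - t) powr (- \<kappa>)"
      by (simp add: c_def J_def)
  qed
qed

lemma filterlim_powr_diff_at_top:
  fixes a l K :: real
  assumes "0 < a" "a < l" "0 < K"
  shows "filterlim (\<lambda>t. t powr l / 2 - K * t powr a) at_top at_top"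
  using assms by real_asymp

lemma tendsto_powr_sum_0:
  fixes a d L K D :: real
  assumes "0 < a" "0 < d" "a + d < 1/2"
  shows "((\<lambda>t. D * t powr (d - 1/2) * (L + K * t powr a)) \<longlongrightarrow> 0) at_top"
proof -
  have "((\<lambda>t. D * t powr (d - 1/2)) \<longlongrightarrow> 0) at_top" "((\<lambda>t. t powr (d - 1/2) * t powr a) \<longlongrightarrow> 0) at_top"
    using assms by real_asymp+
  then have "((\<lambda>t. L * (D * t powr (d - 1/2)) + D * K * (t powr (d - 1/2) * t powr a)) \<longlongrightarrow> L * 0 + D * K * 0) at_top"
    by (intro tendsto_intros)
  then show ?thesis by (simp add: algebra_simps)
qed

text \<open>
  \<open>V \<epsilon>\<close> is \<open>u\<close> or \<open>u_t - u_r\<close>, and \<open>W\<close> is the corresponding profile.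
\<close>

lemma profile_lower_bound:
  fixes V :: "real \<Rightarrow> spacetime \<Rightarrow> 'b::real_normed_vector" and W :: "profile_point \<Rightarrow> 'b"
    and S :: "real \<Rightarrow> (real^3) set"
  assumes K: "K > 0" and b: "b > 0" and C: "C > 0" and \<epsilon>1: "\<epsilon>1 > 0" and \<delta>: "0 < \<delta>"
    and \<kappa>: "\<kappa> \<ge> 0" "\<kappa> + p \<ge> 0"
    and l0: "\<And>lam. 0 < lam \<Longrightarrow> lam < l0 \<Longrightarrow> lam < 1 \<and> lam * (\<kappa> + p) < 1/2"
    and q: "\<And>\<epsilon> t r \<omega>. \<lbrakk>0 < \<epsilon>; \<epsilon> < \<epsilon>1; 1 / \<epsilon> \<le> t; t / 2 \<le> r; r \<le> 3 / 2 * t; norm \<omega> = 1\<rbrakk>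
       \<Longrightarrow> \<bar>q \<epsilon> (t, r *\<^sub>R \<omega>) - (r - t)\<bar> \<le> K * t powr (b * \<epsilon>)"
    and V: "\<And>\<epsilon> t r \<omega>. \<lbrakk>0 < \<epsilon>; \<epsilon> < \<epsilon>1; 1 / \<epsilon> \<le> t; t / 2 \<le> r; r \<le> 3 / 2 * t; norm \<omega> = 1\<rbrakk>
       \<Longrightarrow> norm (V \<epsilon> (t, r *\<^sub>R \<omega>) - (\<epsilon> / r) *\<^sub>R W (\<epsilon> * ln t - \<delta>, q \<epsilon> (t, r *\<^sub>R \<omega>), \<omega>))
          \<le> C * \<epsilon> * t powr (-3/2 + C * \<epsilon>) * jb (r - t) powr p"
    and supp: "\<And>\<epsilon>. \<lbrakk>0 < \<epsilon>; \<epsilon> < \<epsilon>1; compact (S \<epsilon>)\<rbrakk> \<Longrightarrow>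
        \<exists>R. \<forall>t>0. \<forall>x. norm x > R + t \<longrightarrow> V \<epsilon> (t, x) = 0"
    and cont: "\<And>p \<omega>. norm \<omega> = 1 \<Longrightarrow> continuous_on {0..} (\<lambda>s. W (s, p, \<omega>))"
  shows "\<exists>c>0. \<forall>C1>0. \<exists>C\<kappa>. \<forall>M>0. \<forall>q0 lam. 0 < lam \<and> lam < l0 \<longrightarrow>
      (\<exists>\<epsilon>0>0. \<forall>s0>1. \<forall>\<omega>0\<in>sphere 0 1.
        (\<forall>s>s0. \<forall>p>q0. norm (W (s, p, \<omega>0)) \<ge> M * jb p powr (- \<kappa>) * exp (- C1 * s)) \<longrightarrow>
        (\<forall>\<epsilon>. 0 < \<epsilon> \<and> \<epsilon> < \<epsilon>0 \<longrightarrow>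
          (\<forall>t r. t \<ge> exp ((s0 + \<delta>) / \<epsilon>) \<and> r > 0 \<and> \<bar>r - t\<bar> < t powr lam \<and>
                 q \<epsilon> (t, r *\<^sub>R \<omega>0) > q0 \<longrightarrow>
             norm (V \<epsilon> (t, r *\<^sub>R \<omega>0))
               \<ge> c * M * \<epsilon> * t powr (-1 - C\<kappa> * \<epsilon>) * jb (r - t) powr (- \<kappa>)) \<and>
          \<not> compact (S \<epsilon>)))"
proof (rule exI[of _ "(1 + K) powr (- \<kappa>) / 4"], rule conjI, goal_cases)
  case 1
  show ?case using K by simp
next
  case 2
  have c: "(1 + K) powr (- \<kappa>) / 4 > 0" using K by simp
  have "\<exists>C\<kappa>. \<forall>M>0. \<forall>q0 lam. 0 < lam \<and> lam < l0 \<longrightarrow>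
      (\<exists>\<epsilon>0>0. \<forall>s0>1. \<forall>\<omega>0\<in>sphere 0 1.
        (\<forall>s>s0. \<forall>p>q0. norm (W (s, p, \<omega>0)) \<ge> M * jb p powr (- \<kappa>) * exp (- C1 * s)) \<longrightarrow>
        (\<forall>\<epsilon>. 0 < \<epsilon> \<and> \<epsilon> < \<epsilon>0 \<longrightarrow>
          (\<forall>t r. t \<ge> exp ((s0 + \<delta>) / \<epsilon>) \<and> r > 0 \<and> \<bar>r - t\<bar> < t powr lam \<and>
                 q \<epsilon> (t, r *\<^sub>R \<omega>0) > q0 \<longrightarrow>
             norm (V \<epsilon> (t, r *\<^sub>R \<omega>0))
               \<ge> (1 + K) powr (- \<kappa>) / 4 * M * \<epsilon> * t powr (-1 - C\<kappa> * \<epsilon>) * jb (r - t) powr (- \<kappa>)) \<and>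
          \<not> compact (S \<epsilon>)))"
    if C1: "C1 > 0" for C1
  proof (rule exI[of _ "b * \<kappa> + C1"], intro allI impI, elim conjE)
    fix M q0 lam :: real
    assume M: "M > 0" and lam: "0 < lam" "lam < l0"
    note lam = lam(1) l0[OF lam, THEN conjunct1] l0[OF lam, THEN conjunct2]
    obtain \<epsilon>2 where \<epsilon>2: "\<epsilon>2 > 0"
      and LB: "\<And>\<epsilon> t r Q (V :: 'b) W.
        \<lbrakk>0 < \<epsilon>; \<epsilon> < \<epsilon>2; exp (1 / \<epsilon>) \<le> t; \<bar>r - t\<bar> < t powr lam; \<bar>Q - (r - t)\<bar> \<le> K * t powr (b * \<epsilon>);
         norm (V - (\<epsilon> / r) *\<^sub>R W) \<le> C * \<epsilon> * t powr (-3/2 + C * \<epsilon>) * jb (r - t) powr p;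
         norm W \<ge> M * jb Q powr (- \<kappa>) * exp (- C1 * (\<epsilon> * ln t - \<delta>))\<rbrakk>
        \<Longrightarrow> norm V \<ge> (1 + K) powr (- \<kappa>) / 4 * M * \<epsilon> * t powr (-1 - (b * \<kappa> + C1) * \<epsilon>) * jb (r - t) powr (- \<kappa>)"
      and half: "\<And>\<epsilon> t. \<lbrakk>0 < \<epsilon>; \<epsilon> < \<epsilon>2; exp (1 / \<epsilon>) \<le> t\<rbrakk> \<Longrightarrow> t powr lam \<le> t / 2"
      using lower_bound_of_approximation[OF K b C \<kappa> lam C1 \<delta> M, where 'a='b] by blast
    \<comment> \<open>The entry \<open>lam / b\<close> gives \<open>b * \<epsilon> < lam\<close>: at
      distance of order \<open>t powr lam\<close> from the light cone the error in \<open>q\<close>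
      is of lower order.\<close>
    define \<epsilon>0 where "\<epsilon>0 = min (min \<epsilon>1 \<epsilon>2) (lam / b)"
    have "\<epsilon>0 > 0" using \<epsilon>1 \<epsilon>2 lam b by (simp add: \<epsilon>0_def)
    moreover have "norm (V \<epsilon> (t, r *\<^sub>R \<omega>0))
               \<ge> (1 + K) powr (- \<kappa>) / 4 * M * \<epsilon> * t powr (-1 - (b * \<kappa> + C1) * \<epsilon>) * jb (r - t) powr (- \<kappa>)"
      if s0: "s0 > 1" and \<omega>0: "\<omega>0 \<in> sphere 0 1"
        and W: "\<forall>s>s0. \<forall>p>q0. norm (W (s, p, \<omega>0)) \<ge> M * jb p powr (- \<kappa>) * exp (- C1 * s)"
        and \<epsilon>: "0 < \<epsilon>" "\<epsilon> < \<epsilon>0" and t: "t \<ge> exp ((s0 + \<delta>) / \<epsilon>)"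
        and r: "\<bar>r - t\<bar> < t powr lam" and q0: "q \<epsilon> (t, r *\<^sub>R \<omega>0) > q0"
      for s0 \<omega>0 \<epsilon> t r
    proof (rule LB)
      have n\<omega>: "norm \<omega>0 = 1" using \<omega>0 by simp
      have \<epsilon>': "\<epsilon> < \<epsilon>1" "\<epsilon> < \<epsilon>2" using \<epsilon> by (auto simp: \<epsilon>0_def)
      have "exp (1 / \<epsilon>) \<le> exp ((s0 + \<delta>) / \<epsilon>)" using s0 \<delta> \<epsilon> by (simp add: divide_right_mono)
      then show t': "exp (1 / \<epsilon>) \<le> t" using t by linarith
      have "1 / \<epsilon> \<le> t" using exp_ge_add_one_self[of "1 / \<epsilon>"] t' by linarith
      moreover have "t / 2 \<le> r" "r \<le> 3 / 2 * t" using half[OF \<epsilon>(1) \<epsilon>'(2) t'] r by auto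
      ultimately show "\<bar>q \<epsilon> (t, r *\<^sub>R \<omega>0) - (r - t)\<bar> \<le> K * t powr (b * \<epsilon>)"
        and "norm (V \<epsilon> (t, r *\<^sub>R \<omega>0) - (\<epsilon> / r) *\<^sub>R W (\<epsilon> * ln t - \<delta>, q \<epsilon> (t, r *\<^sub>R \<omega>0), \<omega>0))
          \<le> C * \<epsilon> * t powr (-3/2 + C * \<epsilon>) * jb (r - t) powr p"
        using q V \<epsilon> \<epsilon>' n\<omega> by blast+
      let ?q = "q \<epsilon> (t, r *\<^sub>R \<omega>0)"
      have "(s0 + \<delta>) / \<epsilon> \<le> ln t" using t by (metis exp_gt_zero ln_exp ln_mono)
      \<comment> \<open>At the earliest time allowed, \<open>\<epsilon> * ln t - \<delta>\<close>
        equals \<open>s0\<close>, where the hypothesis on \<open>W\<close> is silent; continuity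
        extends it to the closure.\<close>
      then have s: "\<epsilon> * ln t - \<delta> \<in> closure {s0<..}" using \<epsilon> by (simp add: field_simps)
      have "continuous_on (closure {s0<..})
          (\<lambda>s. norm (W (s, ?q, \<omega>0)) - M * jb ?q powr (- \<kappa>) * exp (- C1 * s))"
        using continuous_on_subset[OF cont[OF n\<omega>, of ?q]] s0 by (intro continuous_intros) auto
      moreover have "norm (W (s, ?q, \<omega>0)) - M * jb ?q powr (- \<kappa>) * exp (- C1 * s) \<ge> 0" if "s \<in> {s0<..}" for s
        using W q0 that by simp
      ultimately have "norm (W (\<epsilon> * ln t - \<delta>, ?q, \<omega>0))
          - M * jb ?q powr (- \<kappa>) * exp (- C1 * (\<epsilon> * ln t - \<delta>)) \<ge> 0"
        by (rule continuous_ge_on_closure[OF _ s])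
      then show "norm (W (\<epsilon> * ln t - \<delta>, ?q, \<omega>0)) \<ge> M * jb ?q powr (- \<kappa>) * exp (- C1 * (\<epsilon> * ln t - \<delta>))"
        by simp
    qed (use \<epsilon> r in \<open>auto simp: \<epsilon>0_def\<close>)
    note bound = this
    moreover have "\<not> compact (S \<epsilon>)"
      if s0: "s0 > 1" and \<omega>0: "\<omega>0 \<in> sphere 0 1"
        and W: "\<forall>s>s0. \<forall>p>q0. norm (W (s, p, \<omega>0)) \<ge> M * jb p powr (- \<kappa>) * exp (- C1 * s)"
        and \<epsilon>: "0 < \<epsilon>" "\<epsilon> < \<epsilon>0"
      for s0 \<omega>0 \<epsilon>
    proof
      assume "compact (S \<epsilon>)"
      then obtain R where R: "\<And>t x. t > 0 \<Longrightarrow> norm x > R + t \<Longrightarrow> V \<epsilon> (t, x) = 0"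
        using supp[of \<epsilon>] \<epsilon> by (auto simp: \<epsilon>0_def)
      have \<epsilon>': "\<epsilon> < \<epsilon>1" "\<epsilon> < \<epsilon>2" "b * \<epsilon> < lam" using \<epsilon> b by (auto simp: \<epsilon>0_def field_simps)
      \<comment> \<open>For such \<open>t\<close> the point at \<open>r = t + t powr lam / 2\<close>
        has both \<open>q > q0\<close>, so the lower bound applies, and \<open>r > R + t\<close>, so
        \<open>V\<close> vanishes.\<close>
      have "eventually (\<lambda>t. t powr lam / 2 - K * t powr (b * \<epsilon>) > max q0 R) at_top"
        using filterlim_powr_diff_at_top[of "b * \<epsilon>" lam K] b \<epsilon> \<epsilon>' K
        by (intro filterlim_at_top_dense[THEN iffD1, rule_format]) auto
      moreover have "eventually (\<lambda>t. t \<ge> exp ((s0 + \<delta>) / \<epsilon>)) at_top" by (rule eventually_ge_at_top)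
      ultimately obtain t where t: "t powr lam / 2 - K * t powr (b * \<epsilon>) > max q0 R" "t \<ge> exp ((s0 + \<delta>) / \<epsilon>)"
        using eventually_happens'[OF _ eventually_conj] by (metis (no_types, lifting) trivial_limit_at_top_linorder)
      define r where "r = t + t powr lam / 2"
      have t0: "t > 0" using t(2) by (meson exp_gt_zero less_le_trans)
      have "exp (1 / \<epsilon>) \<le> exp ((s0 + \<delta>) / \<epsilon>)" using s0 \<delta> \<epsilon> by (simp add: divide_right_mono)
      then have t': "exp (1 / \<epsilon>) \<le> t" using t by linarith
      have "1 / \<epsilon> \<le> t" using exp_ge_add_one_self[of "1 / \<epsilon>"] t' by linarith
      moreover have "t / 2 \<le> r" "r \<le> 3 / 2 * t" using half[OF \<epsilon>(1) \<epsilon>'(2) t'] t0 by (auto simp: r_def)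
      moreover have n\<omega>: "norm \<omega>0 = 1" using \<omega>0 by simp
      ultimately have "\<bar>q \<epsilon> (t, r *\<^sub>R \<omega>0) - (r - t)\<bar> \<le> K * t powr (b * \<epsilon>)"
        using q \<epsilon> \<epsilon>' by blast
      then have "q \<epsilon> (t, r *\<^sub>R \<omega>0) > q0" using t by (simp add: r_def abs_le_iff)
      moreover have "\<bar>r - t\<bar> < t powr lam" using t0 by (simp add: r_def)
      ultimately have "norm (V \<epsilon> (t, r *\<^sub>R \<omega>0))
               \<ge> (1 + K) powr (- \<kappa>) / 4 * M * \<epsilon> * t powr (-1 - (b * \<kappa> + C1) * \<epsilon>) * jb (r - t) powr (- \<kappa>)"
        using bound[OF s0 \<omega>0 W \<epsilon> t(2)] by blast
      moreover have "(1 + K) powr (- \<kappa>) / 4 * M * \<epsilon> * t powr (-1 - (b * \<kappa> + C1) * \<epsilon>) * jb (r - t) powr (- \<kappa>) > 0"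
        using c M \<epsilon> t0 jb_ge_1[of "r - t"] by (intro mult_pos_pos) auto
      moreover have "V \<epsilon> (t, r *\<^sub>R \<omega>0) = 0"
      proof (rule R[OF t0])
        have "K * t powr (b * \<epsilon>) \<ge> 0" using K by simp
        then have "t powr lam / 2 > R" using t(1) by linarith
        then show "norm (r *\<^sub>R \<omega>0) > R + t" using n\<omega> t0 by (simp add: r_def)
      qed
      ultimately show False by simp
    qed
    ultimately show "\<exists>\<epsilon>0>0. \<forall>s0>1. \<forall>\<omega>0\<in>sphere 0 1.
        (\<forall>s>s0. \<forall>p>q0. norm (W (s, p, \<omega>0)) \<ge> M * jb p powr (- \<kappa>) * exp (- C1 * s)) \<longrightarrow>
        (\<forall>\<epsilon>. 0 < \<epsilon> \<and> \<epsilon> < \<epsilon>0 \<longrightarrow>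
          (\<forall>t r. t \<ge> exp ((s0 + \<delta>) / \<epsilon>) \<and> r > 0 \<and> \<bar>r - t\<bar> < t powr lam \<and>
                 q \<epsilon> (t, r *\<^sub>R \<omega>0) > q0 \<longrightarrow>
             norm (V \<epsilon> (t, r *\<^sub>R \<omega>0))
               \<ge> (1 + K) powr (- \<kappa>) / 4 * M * \<epsilon> * t powr (-1 - (b * \<kappa> + C1) * \<epsilon>) * jb (r - t) powr (- \<kappa>)) \<and>
          \<not> compact (S \<epsilon>))"
      by (intro exI[of _ \<epsilon>0] conjI) blast+
  qed
  then show ?case by blast
qed

text \<open>Serves the limiting value \<open>s = s0\<close> of the lower-bound hypotheses; the
  half-line from 0 contains it because \<open>s0 > 1\<close>.\<close>

lemma profile_continuous_in_s:
  assumes rs: "reduced_solution g2 g3 f2 \<delta>0 \<mu> U" and \<delta>0: "0 < \<delta>0" and \<omega>: "norm \<omega> = 1"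
  shows "continuous_on {0..} (\<lambda>s. U (s, p, \<omega>))"
    and "continuous_on {0..} (\<lambda>s. muUq \<delta>0 \<mu> U (s, p, \<omega>))"
proof -
  have path: "continuous_on {0..} (\<lambda>s. H (s, p, \<omega>))" if "continuous_on (profile_cone \<delta>0) H"
    for H :: "profile_point \<Rightarrow> 'x::topological_space"
    by (rule continuous_on_compose2[OF that])
      (use \<delta>0 \<omega> in \<open>auto simp: profile_cone_def intro!: continuous_intros\<close>)
  have hom: "hom_ext H (s, p, \<omega>) = H (s, p, \<omega>)" for H :: "profile_point \<Rightarrow> 'x" and s
    using \<omega> by (simp add: hom_ext_def sgn_div_norm)
  have U: "Ck_on (Suc 0) (profile_cone \<delta>0) (hom_ext U)" "Ck_on 0 (profile_cone \<delta>0) (hom_ext U)"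
    and \<mu>: "Ck_on 0 (profile_cone \<delta>0) (hom_ext \<mu>)"
    using rs unfolding reduced_solution_def profile_smooth_def smooth_on_def by blast+
  have "(0, 1, 0) \<in> (Basis :: profile_point set)" by (auto simp: Basis_prod_def)
  then have "continuous_on (profile_cone \<delta>0) (d_q \<delta>0 U)" using U(1) by (simp add: d_q_def)
  from path[OF this] path[of "hom_ext U"] path[of "hom_ext \<mu>"]
  show "continuous_on {0..} (\<lambda>s. U (s, p, \<omega>))"
    and "continuous_on {0..} (\<lambda>s. muUq \<delta>0 \<mu> U (s, p, \<omega>))"
    using U(2) \<mu> unfolding muUq_def by (simp_all add: hom continuous_intros)
qed

text \<open>The hypothesis of (a) concerns a single \<open>q0\<close>, so a point with
  \<open>q\<close> exactly equal to \<open>q0\<close> is required. Along a ray \<open>q\<close> is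
  \<open>- t / 2\<close> at \<open>r = t / 2\<close>, by the prescribed values, and close to
  \<open>t / 2\<close> at \<open>r = 3 / 2 * t\<close>; between them the intermediate value theorem
  applies.\<close>

lemma optical_level_point:
  assumes opt: "optical_function \<delta> \<mu> \<epsilon> q" and \<epsilon>: "0 < \<epsilon>" and t: "1 / \<epsilon> \<le> t" and \<omega>: "norm \<omega> = 1"
    and near: "\<bar>q (t, (3/2 * t) *\<^sub>R \<omega>) - t / 2\<bar> \<le> E" and q0: "\<bar>q0\<bar> + E \<le> t / 2"
  obtains r where "t / 2 \<le> r" "r \<le> 3 / 2 * t" "q (t, r *\<^sub>R \<omega>) = q0"
proof -
  have t0: "t > 0" using \<epsilon> t by (meson less_le_trans zero_less_divide_1_iff)
  have ext: "(t, r *\<^sub>R \<omega>) \<in> exterior \<epsilon>" if "t / 2 \<le> r" for r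
    using that t0 t \<omega> by (simp add: exterior_def)
  have "q (t, (t / 2) *\<^sub>R \<omega>) = - norm ((t / 2) *\<^sub>R \<omega>)"
    using opt ext[of "t / 2"] t0 \<omega> unfolding optical_function_def by fastforce
  then have "q (t, (t / 2) *\<^sub>R \<omega>) = - (t / 2)" using t0 \<omega> by simp
  moreover have "continuous_on (exterior \<epsilon>) q"
    using opt by (simp add: optical_function_def differentiable_imp_continuous_on)
  then have "continuous_on {t / 2..3 / 2 * t} (\<lambda>r. q (t, r *\<^sub>R \<omega>))"
    by (rule continuous_on_compose2) (use ext in \<open>auto intro!: continuous_intros\<close>)
  ultimately have "\<exists>r\<ge>t / 2. r \<le> 3 / 2 * t \<and> q (t, r *\<^sub>R \<omega>) = q0"
    using near q0 t0 by (intro IVT') (auto simp: abs_le_iff)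
  then show thesis using that by blast
qed

text \<open>The order of quantifiers encodes the uniformity of the constants: \<open>c\<close> and
  \<open>C\<kappa>\<close> precede \<open>M\<close>, and the threshold precedes \<open>s0\<close>
  and \<open>\<omega>0\<close>.\<close>

theorem proposition7p4:
  fixes g :: "st_index \<Rightarrow> st_index \<Rightarrow> (real^'m) \<times> (real^'m^st_index) \<Rightarrow> real"
    and f :: "(real^'m) \<times> (real^'m^st_index) \<Rightarrow> real^'m"
    and g2 :: "'m \<Rightarrow> st_index \<Rightarrow> st_index \<Rightarrow> real"
    and g3 :: "'m \<Rightarrow> st_index \<Rightarrow> st_index \<Rightarrow> st_index \<Rightarrow> real"
    and f2 :: "'m \<Rightarrow> 'm \<Rightarrow> 'm \<Rightarrow> st_index \<Rightarrow> st_index \<Rightarrow> real"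
    and \<mu> :: "profile_point \<Rightarrow> real" and U :: "profile_point \<Rightarrow> real^'m"
    and \<gamma>p \<gamma>m \<delta>0 :: real
  assumes "quasilinear_system g f g2 g3 f2"
    and "\<gamma>p > 1" and "\<gamma>m > 2" and "0 < \<delta>0" and "\<delta>0 < 1"
    and "reduced_solution g2 g3 f2 \<delta>0 \<mu> U"
    and "admissible g2 g3 \<gamma>p \<gamma>m \<delta>0 \<mu> U"
  shows "\<exists>\<delta>1>0. \<forall>\<delta> N \<gamma>1 q u.
    0 < \<delta> \<and> \<delta> < \<delta>0 \<and> \<delta> < \<delta>1 \<and> N \<ge> 2 \<and> 2 < \<gamma>1 \<and> \<gamma>1 < min 4 (2 * (\<gamma>m - 1)) \<and>
    matching_family g f N \<gamma>1 \<delta>0 \<delta> \<mu> U q u \<longrightarrow>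
    \<comment> \<open>(a)\<close>
    ((\<exists>s0 q0 \<omega>0 c1 C1. s0 > 1 \<and> \<omega>0 \<in> sphere 0 1 \<and> c1 > 0 \<and> C1 > 0 \<and>
        (\<forall>s>s0. norm (U (s, q0, \<omega>0)) + norm (muUq \<delta>0 \<mu> U (s, q0, \<omega>0)) \<ge> c1 * exp (- C1 * s)))
      \<longrightarrow> (\<forall>\<^sub>F \<epsilon> in at_right 0. \<exists>z\<in>upper_half. u \<epsilon> z \<noteq> 0)) \<and>
    \<comment> \<open>(b)\<close>
    (\<forall>\<kappa>\<ge>0. \<exists>c>0. \<forall>C1>0. \<exists>C\<kappa>. \<forall>M>0. \<forall>q0 lam. 0 < lam \<and> lam < 1 / (2 * \<kappa> + 1) \<longrightarrow>
      (\<exists>\<epsilon>0>0. \<forall>s0>1. \<forall>\<omega>0\<in>sphere 0 1.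
        (\<forall>s>s0. \<forall>p>q0. norm (U (s, p, \<omega>0)) \<ge> M * jb p powr (- \<kappa>) * exp (- C1 * s)) \<longrightarrow>
        (\<forall>\<epsilon>. 0 < \<epsilon> \<and> \<epsilon> < \<epsilon>0 \<longrightarrow>
          (\<forall>t r. t \<ge> exp ((s0 + \<delta>) / \<epsilon>) \<and> r > 0 \<and> \<bar>r - t\<bar> < t powr lam \<and>
                 q \<epsilon> (t, r *\<^sub>R \<omega>0) > q0 \<longrightarrow>
             norm (u \<epsilon> (t, r *\<^sub>R \<omega>0))
               \<ge> c * M * \<epsilon> * t powr (-1 - C\<kappa> * \<epsilon>) * jb (r - t) powr (- \<kappa>)) \<and>
          \<not> compact (data_support (u \<epsilon>))))) \<and>
    \<comment> \<open>(c)\<close>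
    (\<forall>\<kappa>\<ge>1. \<exists>c>0. \<forall>C1>0. \<exists>C\<kappa>. \<forall>M>0. \<forall>q0 lam. 0 < lam \<and> lam < 1 / (2 * \<kappa> - 1) \<longrightarrow>
      (\<exists>\<epsilon>0>0. \<forall>s0>1. \<forall>\<omega>0\<in>sphere 0 1.
        (\<forall>s>s0. \<forall>p>q0. norm (muUq \<delta>0 \<mu> U (s, p, \<omega>0)) \<ge> M * jb p powr (- \<kappa>) * exp (- C1 * s)) \<longrightarrow>
        (\<forall>\<epsilon>. 0 < \<epsilon> \<and> \<epsilon> < \<epsilon>0 \<longrightarrow>
          (\<forall>t r. t \<ge> exp ((s0 + \<delta>) / \<epsilon>) \<and> r > 0 \<and> \<bar>r - t\<bar> < t powr lam \<and>
                 q \<epsilon> (t, r *\<^sub>R \<omega>0) > q0 \<longrightarrow>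
             norm (d_t upper_half (u \<epsilon>) (t, r *\<^sub>R \<omega>0) - d_r upper_half (u \<epsilon>) (t, r *\<^sub>R \<omega>0))
               \<ge> c * M * \<epsilon> * t powr (-1 - C\<kappa> * \<epsilon>) * jb (r - t) powr (- \<kappa>)) \<and>
          \<not> compact (data_support (u \<epsilon>)))))"
proof (rule exI[of _ 1], rule conjI[OF zero_less_one], (rule allI)+, rule impI, goal_cases)
  case (1 \<delta> N \<gamma>1 q u)
  note qs = assms(1) and rs = assms(6)
  have \<delta>: "0 < \<delta>" "\<delta> < \<delta>0" and N: "N \<ge> 2" and \<gamma>1: "2 < \<gamma>1" using 1 by auto
  obtain C where C: "C > 0" and ev: "\<forall>\<^sub>F \<epsilon> in at_right 0.
        optical_function \<delta> \<mu> \<epsilon> (q \<epsilon>) \<and> Ck_on N upper_half (u \<epsilon>) \<and> QW_solution g f (u \<epsilon>) \<and>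
        matches_with C N \<gamma>1 \<delta>0 \<delta> \<mu> U \<epsilon> (q \<epsilon>) (u \<epsilon>)"
    using 1 unfolding matching_family_def by blast
  obtain \<epsilon>' where \<epsilon>': "\<epsilon>' > 0" "\<And>\<epsilon>. 0 < \<epsilon> \<Longrightarrow> \<epsilon> < \<epsilon>' \<Longrightarrow>
        optical_function \<delta> \<mu> \<epsilon> (q \<epsilon>) \<and> Ck_on N upper_half (u \<epsilon>) \<and> QW_solution g f (u \<epsilon>) \<and>
        matches_with C N \<gamma>1 \<delta>0 \<delta> \<mu> U \<epsilon> (q \<epsilon>) (u \<epsilon>)"
    using ev unfolding eventually_at_right_field by auto
  define \<epsilon>1 where "\<epsilon>1 = min \<epsilon>' 1"
  have \<epsilon>1: "\<epsilon>1 > 0" "\<epsilon>1 \<le> 1" using \<epsilon>'(1) by (auto simp: \<epsilon>1_def)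
  have opt: "optical_function \<delta> \<mu> \<epsilon> (q \<epsilon>)" and C2: "Ck_on 2 upper_half (u \<epsilon>)"
    and sol: "QW_solution g f (u \<epsilon>)" and mat: "matches_with C N \<gamma>1 \<delta>0 \<delta> \<mu> U \<epsilon> (q \<epsilon>) (u \<epsilon>)"
    if "0 < \<epsilon>" "\<epsilon> < \<epsilon>1" for \<epsilon>
    using \<epsilon>'(2)[of \<epsilon>] that N Ck_on_mono by (auto simp: \<epsilon>1_def)
  obtain K b where K: "K > 0" "b > 0" and q: "\<And>\<epsilon> q t r \<omega>. \<lbrakk>0 < \<epsilon>; \<epsilon> < 1; optical_function \<delta> \<mu> \<epsilon> q;
      1 / \<epsilon> \<le> t; t / 2 \<le> r; r \<le> 2 * t; norm \<omega> = 1\<rbrakk>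
       \<Longrightarrow> \<bar>q (t, r *\<^sub>R \<omega>) - (r - t)\<bar> \<le> K * t powr (b * \<epsilon>)"
    using optical_function_near[OF assms(7) assms(2) _ \<delta> assms(5)] assms(3) by auto
  have q': "\<bar>q \<epsilon> (t, r *\<^sub>R \<omega>) - (r - t)\<bar> \<le> K * t powr (b * \<epsilon>)"
    if "0 < \<epsilon>" "\<epsilon> < \<epsilon>1" "1 / \<epsilon> \<le> t" "t / 2 \<le> r" "r \<le> 3 / 2 * t" "norm \<omega> = 1" for \<epsilon> t r \<omega>
  proof (rule q)
    show "r \<le> 2 * t" using that by linarith
  qed (use that \<epsilon>1 opt in auto)
  define V where "V \<epsilon> z = d_t upper_half (u \<epsilon>) z - d_r upper_half (u \<epsilon>) z" for \<epsilon> z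
  note app = matches_pointwise[OF mat C \<gamma>1]
  have speed: "\<exists>R. \<forall>t\<ge>0. \<forall>x. norm x > R + t \<longrightarrow> u \<epsilon> (t, x) = 0"
    if "0 < \<epsilon>" "\<epsilon> < \<epsilon>1" "compact (data_support (u \<epsilon>))" for \<epsilon>
    by (rule QW_finite_speed[OF qs sol C2]) (use that in auto)
  \<comment> \<open>\<open>W\<close> will be the exterior of a cone in \<open>speed'\<close> and the
    whole space in (a).\<close>
  have V_0: "V \<epsilon> (t, x) = 0" if "t > 0" "open W" "(t, x) \<in> W" "\<And>z. z \<in> W \<Longrightarrow> z \<in> upper_half \<Longrightarrow> u \<epsilon> z = 0"
    for \<epsilon> t x W
    using pd_eq_0_if_locally_0[OF interior_upper_half[OF that(1)] that(2-4)]
    by (simp add: V_def d_t_def d_r_def)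
  have speed': "\<exists>R. \<forall>t>0. \<forall>x. norm x > R + t \<longrightarrow> V \<epsilon> (t, x) = 0"
    if \<epsilon>: "0 < \<epsilon>" "\<epsilon> < \<epsilon>1" "compact (data_support (u \<epsilon>))" for \<epsilon>
  proof -
    obtain R where R: "\<And>t x. t \<ge> 0 \<Longrightarrow> norm x > R + t \<Longrightarrow> u \<epsilon> (t, x) = 0"
      using speed[OF \<epsilon>] by blast
    have "V \<epsilon> (t, x) = 0" if "t > 0" "norm x > R + t" for t x
    proof (rule V_0[OF that(1)])
      show "open {z :: spacetime. norm (snd z) > R + fst z}"
        by (intro open_Collect_less continuous_intros)
    qed (use that R in \<open>auto simp: upper_half_def\<close>)
    then show ?thesis by blast
  qed

  \<comment> \<open>Part (a): the solution is not identically zero\<close>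
  have a: "\<forall>\<^sub>F \<epsilon> in at_right 0. \<exists>z\<in>upper_half. u \<epsilon> z \<noteq> 0"
    if \<omega>0: "\<omega>0 \<in> sphere 0 1" and c1: "c1 > 0" "C1 > 0"
      and lb: "\<forall>s>s0. norm (U (s, q0, \<omega>0)) + norm (muUq \<delta>0 \<mu> U (s, q0, \<omega>0)) \<ge> c1 * exp (- C1 * s)"
    for s0 q0 \<omega>0 c1 C1
    unfolding eventually_at_right_field
  proof (intro exI[of _ "min \<epsilon>1 (1 / (2 * (C + C1 + b)))"] conjI allI impI)
    \<comment> \<open>The threshold makes the total loss in the exponent smaller than the gain 1/2;
      constants such as \<open>c1\<close> and \<open>q0\<close> are beaten by letting
      \<open>t\<close> tend to infinity.\<close>
    have pos: "C + C1 + b > 0" using C c1 K by simp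
    then show "0 < min \<epsilon>1 (1 / (2 * (C + C1 + b)))" using \<epsilon>1 by simp
    fix \<epsilon> :: real assume "0 < \<epsilon>" and "\<epsilon> < min \<epsilon>1 (1 / (2 * (C + C1 + b)))"
    then have \<epsilon>: "0 < \<epsilon>" "\<epsilon> < \<epsilon>1" "b * \<epsilon> + (C + C1) * \<epsilon> < 1/2"
      using pos by (auto simp: field_simps)
    show "\<exists>z\<in>upper_half. u \<epsilon> z \<noteq> 0"
    proof (rule ccontr)
      assume "\<not> (\<exists>z\<in>upper_half. u \<epsilon> z \<noteq> 0)"
      then have u0: "\<And>z. z \<in> upper_half \<Longrightarrow> u \<epsilon> z = 0" by blast
      have n\<omega>: "norm \<omega>0 = 1" using \<omega>0 by simp
      let ?E = "\<lambda>t. K * t powr (b * \<epsilon>)"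
      have "eventually (\<lambda>t. 4 * C * t powr ((C + C1) * \<epsilon> - 1/2) * (1 + \<bar>q0\<bar> + ?E t) < c1) at_top"
        using tendsto_powr_sum_0[of "b * \<epsilon>" "(C + C1) * \<epsilon>" "4 * C" "1 + \<bar>q0\<bar>" K] \<epsilon> K C c1
        by (intro order_tendstoD(2)) auto
      moreover have "eventually (\<lambda>t. t powr 1 / 2 - ?E t > \<bar>q0\<bar>) at_top"
      proof -
        have "(C + C1) * \<epsilon> \<ge> 0" using \<epsilon> C c1 by (intro mult_nonneg_nonneg) auto
        then have "b * \<epsilon> < 1" using \<epsilon>(3) by linarith
        then show ?thesis using filterlim_powr_diff_at_top[of "b * \<epsilon>" 1 K] \<epsilon> K
          by (intro filterlim_at_top_dense[THEN iffD1, rule_format]) auto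
      qed
      moreover have "eventually (\<lambda>t. t > max (1 / \<epsilon>) (exp ((s0 + \<delta>) / \<epsilon>))) at_top"
        by (rule eventually_gt_at_top)
      ultimately have "eventually (\<lambda>t. 4 * C * t powr ((C + C1) * \<epsilon> - 1/2) * (1 + \<bar>q0\<bar> + ?E t) < c1
          \<and> t powr 1 / 2 - ?E t > \<bar>q0\<bar> \<and> t > max (1 / \<epsilon>) (exp ((s0 + \<delta>) / \<epsilon>))) at_top"
        by (intro eventually_conj)
      then obtain t where t: "4 * C * t powr ((C + C1) * \<epsilon> - 1/2) * (1 + \<bar>q0\<bar> + ?E t) < c1"
          "t powr 1 / 2 - ?E t > \<bar>q0\<bar>" "t > 1 / \<epsilon>" "t > exp ((s0 + \<delta>) / \<epsilon>)"
        by (auto dest: eventually_happens'[rotated])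
      have t0: "t > 0" using t(4) by (meson exp_gt_zero less_trans)
      have "\<bar>q \<epsilon> (t, (3/2 * t) *\<^sub>R \<omega>0) - t / 2\<bar> \<le> ?E t"
        using q'[OF \<epsilon>(1,2), of t "3/2 * t" \<omega>0] t t0 n\<omega> by (simp add: algebra_simps)
      then obtain r where r: "t / 2 \<le> r" "r \<le> 3 / 2 * t" and qr: "q \<epsilon> (t, r *\<^sub>R \<omega>0) = q0"
        by (rule optical_level_point[OF opt[OF \<epsilon>(1,2)] \<epsilon>(1) less_imp_le[OF t(3)] n\<omega>, where ?q0.0 = q0])
          (use t t0 in auto)
      define s where "s = \<epsilon> * ln t - \<delta>"
      have "(s0 + \<delta>) / \<epsilon> < ln t" using t(4) t0 by (metis ln_exp ln_less_cancel_iff exp_gt_zero)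
      then have s: "s > s0" using \<epsilon> by (simp add: s_def field_simps)
      define J where "J = jb (r - t)"
      have J1: "J \<ge> 1" by (simp add: J_def jb_ge_1)
      \<comment> \<open>On the level set of \<open>q0\<close>, \<open>r - t\<close> is
        \<open>O(t powr (b * \<epsilon>))\<close>. Hence the crude bound of both powers of
        \<open>J\<close> by \<open>J\<close> costs just another small rate.\<close>
      have "\<bar>q0 - (r - t)\<bar> \<le> ?E t" using q'[OF \<epsilon>(1,2) _ r n\<omega>] t qr by simp
      then have J: "J \<le> 1 + \<bar>q0\<bar> + ?E t" using jb_le[of "r - t"] by (simp add: J_def)
      define D where "D = C * \<epsilon> * t powr (-3/2 + C * \<epsilon>)"
      have D0: "D \<ge> 0" using C \<epsilon> by (simp add: D_def)
      have in_S: "(t, r *\<^sub>R \<omega>0) \<in> upper_half" using t0 by (simp add: upper_half_def)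
      have "norm ((\<epsilon> / r) *\<^sub>R U (s, q0, \<omega>0)) \<le> D * J powr (1/2)"
        using app(1)[OF \<epsilon>(1,2,1) less_imp_le[OF t(3)] r n\<omega>] u0[OF in_S] qr by (simp add: s_def D_def J_def)
      moreover have "V \<epsilon> (t, r *\<^sub>R \<omega>0) = 0" by (rule V_0[OF t0 open_UNIV]) (use u0 in auto)
      then have "norm ((\<epsilon> / r) *\<^sub>R muUq \<delta>0 \<mu> U (s, q0, \<omega>0)) \<le> D * J powr (-1/2)"
        using app(2)[OF \<epsilon>(1,2,1) less_imp_le[OF t(3)] r n\<omega>] qr by (simp add: s_def D_def J_def V_def)
      moreover have "J powr (1/2) \<le> J" "J powr (-1/2) \<le> J"
        using powr_mono[of "1/2" 1 J] powr_mono[of "-1/2" 1 J] J1 by auto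
      ultimately have "norm ((\<epsilon> / r) *\<^sub>R U (s, q0, \<omega>0)) + norm ((\<epsilon> / r) *\<^sub>R muUq \<delta>0 \<mu> U (s, q0, \<omega>0)) \<le> D * J + D * J"
        using D0 by (intro add_mono) (auto intro: order_trans mult_left_mono)
      then have "\<epsilon> / r * (norm (U (s, q0, \<omega>0)) + norm (muUq \<delta>0 \<mu> U (s, q0, \<omega>0))) \<le> 2 * D * J"
        using \<epsilon> r t0 by (simp add: distrib_left)
      moreover have "\<epsilon> / (2 * t) * (c1 * exp (- C1 * s)) \<le> \<epsilon> / r * (norm (U (s, q0, \<omega>0)) + norm (muUq \<delta>0 \<mu> U (s, q0, \<omega>0)))"
        using lb s \<epsilon> r t0 c1 by (intro mult_mono divide_left_mono) auto
      ultimately have "\<epsilon> / (2 * t) * (c1 * exp (- C1 * s)) \<le> 2 * D * J" by linarith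
      then have 1: "c1 * exp (- C1 * s) \<le> 4 * C * (t * t powr (-3/2 + C * \<epsilon>)) * J"
        using \<epsilon> t0 by (simp add: D_def field_simps)
      have 2: "t powr (- (C1 * \<epsilon>)) \<le> exp (- C1 * s)"
        using t0 c1 \<delta> by (simp add: powr_def s_def algebra_simps)
      have "c1 * t powr (- (C1 * \<epsilon>)) \<le> 4 * C * (t * t powr (-3/2 + C * \<epsilon>)) * J"
        using order_trans[OF mult_left_mono[OF 2, of c1] 1] c1 by simp
      then have "c1 * t powr (- (C1 * \<epsilon>)) * t powr (C1 * \<epsilon>) \<le> 4 * C * (t * t powr (-3/2 + C * \<epsilon>)) * J * t powr (C1 * \<epsilon>)"
        by (rule mult_right_mono) simp
      also have "c1 * t powr (- (C1 * \<epsilon>)) * t powr (C1 * \<epsilon>) = c1"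
        using t0 by (simp add: mult.assoc flip: powr_add)
      also have "4 * C * (t * t powr (-3/2 + C * \<epsilon>)) * J * t powr (C1 * \<epsilon>) = 4 * C * t powr ((C + C1) * \<epsilon> - 1/2) * J"
      proof -
        have "t powr ((C + C1) * \<epsilon> - 1/2) = t powr (1 + (-3/2 + C * \<epsilon>) + C1 * \<epsilon>)" by (simp add: algebra_simps)
        also have "\<dots> = t * t powr (-3/2 + C * \<epsilon>) * t powr (C1 * \<epsilon>)" using t0 by (simp only: powr_add powr_one)
        finally show ?thesis by simp
      qed
      also have "\<dots> \<le> 4 * C * t powr ((C + C1) * \<epsilon> - 1/2) * (1 + \<bar>q0\<bar> + ?E t)"
        using C by (intro mult_left_mono J) auto
      finally show False using t(1) by linarith
    qed
  qed
  note cont = profile_continuous_in_s[OF rs assms(4)]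
  show ?case
  proof (intro conjI)
    show "(\<exists>s0 q0 \<omega>0 c1 C1. s0 > 1 \<and> \<omega>0 \<in> sphere 0 1 \<and> c1 > 0 \<and> C1 > 0 \<and>
        (\<forall>s>s0. norm (U (s, q0, \<omega>0)) + norm (muUq \<delta>0 \<mu> U (s, q0, \<omega>0)) \<ge> c1 * exp (- C1 * s)))
      \<longrightarrow> (\<forall>\<^sub>F \<epsilon> in at_right 0. \<exists>z\<in>upper_half. u \<epsilon> z \<noteq> 0)"
      using a by blast

  \<comment> \<open>Part (b): lower bound for \<open>u\<close>\<close>
  next
    \<comment> \<open>With \<open>p = 1/2\<close> the requirement
      \<open>lam * (\<kappa> + p) < 1/2\<close> is the stated range of \<open>lam\<close>.\<close>
    have "lam < 1 \<and> lam * (\<kappa> + 1/2) < 1/2" if "\<kappa> \<ge> 0" "0 < lam" "lam < 1 / (2 * \<kappa> + 1)" for \<kappa> lam :: real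
    proof -
      have "lam * (2 * \<kappa> + 1) < 1" using that by (simp add: field_simps)
      moreover have "lam * \<kappa> \<ge> 0" using that by simp
      ultimately show ?thesis by (simp add: algebra_simps)
    qed
    note l0 = this
    \<comment> \<open>The form with \<open>t > 0\<close> is shared with \<open>u_t - u_r\<close>,
      whose vanishing is derived at interior points.\<close>
    have supp: "\<exists>R. \<forall>t>0. \<forall>x. norm x > R + t \<longrightarrow> u \<epsilon> (t, x) = 0"
      if "0 < \<epsilon>" "\<epsilon> < \<epsilon>1" "compact (data_support (u \<epsilon>))" for \<epsilon>
      using speed[OF that] by (meson less_imp_le)
    show "(\<forall>\<kappa>\<ge>0. \<exists>c>0. \<forall>C1>0. \<exists>C\<kappa>. \<forall>M>0. \<forall>q0 lam. 0 < lam \<and> lam < 1 / (2 * \<kappa> + 1) \<longrightarrow>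
      (\<exists>\<epsilon>0>0. \<forall>s0>1. \<forall>\<omega>0\<in>sphere 0 1.
        (\<forall>s>s0. \<forall>p>q0. norm (U (s, p, \<omega>0)) \<ge> M * jb p powr (- \<kappa>) * exp (- C1 * s)) \<longrightarrow>
        (\<forall>\<epsilon>. 0 < \<epsilon> \<and> \<epsilon> < \<epsilon>0 \<longrightarrow>
          (\<forall>t r. t \<ge> exp ((s0 + \<delta>) / \<epsilon>) \<and> r > 0 \<and> \<bar>r - t\<bar> < t powr lam \<and>
                 q \<epsilon> (t, r *\<^sub>R \<omega>0) > q0 \<longrightarrow>
             norm (u \<epsilon> (t, r *\<^sub>R \<omega>0))
               \<ge> c * M * \<epsilon> * t powr (-1 - C\<kappa> * \<epsilon>) * jb (r - t) powr (- \<kappa>)) \<and>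
          \<not> compact (data_support (u \<epsilon>)))))"
    proof (intro allI impI)
      fix \<kappa> :: real assume \<kappa>: "\<kappa> \<ge> 0"
      show "\<exists>c>0. \<forall>C1>0. \<exists>C\<kappa>. \<forall>M>0. \<forall>q0 lam. 0 < lam \<and> lam < 1 / (2 * \<kappa> + 1) \<longrightarrow>
      (\<exists>\<epsilon>0>0. \<forall>s0>1. \<forall>\<omega>0\<in>sphere 0 1.
        (\<forall>s>s0. \<forall>p>q0. norm (U (s, p, \<omega>0)) \<ge> M * jb p powr (- \<kappa>) * exp (- C1 * s)) \<longrightarrow>
        (\<forall>\<epsilon>. 0 < \<epsilon> \<and> \<epsilon> < \<epsilon>0 \<longrightarrow>
          (\<forall>t r. t \<ge> exp ((s0 + \<delta>) / \<epsilon>) \<and> r > 0 \<and> \<bar>r - t\<bar> < t powr lam \<and>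
                 q \<epsilon> (t, r *\<^sub>R \<omega>0) > q0 \<longrightarrow>
             norm (u \<epsilon> (t, r *\<^sub>R \<omega>0))
               \<ge> c * M * \<epsilon> * t powr (-1 - C\<kappa> * \<epsilon>) * jb (r - t) powr (- \<kappa>)) \<and>
          \<not> compact (data_support (u \<epsilon>))))"
        by (rule profile_lower_bound[where p = "1/2" and S = "\<lambda>\<epsilon>. data_support (u \<epsilon>)",
              OF K C \<epsilon>1(1) \<delta>(1) \<kappa> _ l0[OF \<kappa>] q' app(1) supp cont(1)])
          (use \<kappa> in auto)
    qed

  \<comment> \<open>Part (c): lower bound for the incoming null derivative\<close>
  next
    \<comment> \<open>Now \<open>p = -1/2\<close>; \<open>\<kappa> \<ge> 1\<close> keeps the range
      of \<open>lam\<close> below 1.\<close>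
    have "lam < 1 \<and> lam * (\<kappa> + -1/2) < 1/2" if "\<kappa> \<ge> 1" "0 < lam" "lam < 1 / (2 * \<kappa> - 1)" for \<kappa> lam :: real
    proof -
      have "lam * (2 * \<kappa> - 1) < 1" using that by (simp add: field_simps)
      moreover have "lam * (\<kappa> - 1) \<ge> 0" using that by simp
      ultimately show ?thesis by (simp add: algebra_simps)
    qed
    note l0 = this
    show "(\<forall>\<kappa>\<ge>1. \<exists>c>0. \<forall>C1>0. \<exists>C\<kappa>. \<forall>M>0. \<forall>q0 lam. 0 < lam \<and> lam < 1 / (2 * \<kappa> - 1) \<longrightarrow>
      (\<exists>\<epsilon>0>0. \<forall>s0>1. \<forall>\<omega>0\<in>sphere 0 1.
        (\<forall>s>s0. \<forall>p>q0. norm (muUq \<delta>0 \<mu> U (s, p, \<omega>0)) \<ge> M * jb p powr (- \<kappa>) * exp (- C1 * s)) \<longrightarrow>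
        (\<forall>\<epsilon>. 0 < \<epsilon> \<and> \<epsilon> < \<epsilon>0 \<longrightarrow>
          (\<forall>t r. t \<ge> exp ((s0 + \<delta>) / \<epsilon>) \<and> r > 0 \<and> \<bar>r - t\<bar> < t powr lam \<and>
                 q \<epsilon> (t, r *\<^sub>R \<omega>0) > q0 \<longrightarrow>
             norm (d_t upper_half (u \<epsilon>) (t, r *\<^sub>R \<omega>0) - d_r upper_half (u \<epsilon>) (t, r *\<^sub>R \<omega>0))
               \<ge> c * M * \<epsilon> * t powr (-1 - C\<kappa> * \<epsilon>) * jb (r - t) powr (- \<kappa>)) \<and>
          \<not> compact (data_support (u \<epsilon>)))))"
    proof (intro allI impI)
      fix \<kappa> :: real assume \<kappa>: "\<kappa> \<ge> 1"
      then have \<kappa>0: "\<kappa> \<ge> 0" by simp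
      show "\<exists>c>0. \<forall>C1>0. \<exists>C\<kappa>. \<forall>M>0. \<forall>q0 lam. 0 < lam \<and> lam < 1 / (2 * \<kappa> - 1) \<longrightarrow>
      (\<exists>\<epsilon>0>0. \<forall>s0>1. \<forall>\<omega>0\<in>sphere 0 1.
        (\<forall>s>s0. \<forall>p>q0. norm (muUq \<delta>0 \<mu> U (s, p, \<omega>0)) \<ge> M * jb p powr (- \<kappa>) * exp (- C1 * s)) \<longrightarrow>
        (\<forall>\<epsilon>. 0 < \<epsilon> \<and> \<epsilon> < \<epsilon>0 \<longrightarrow>
          (\<forall>t r. t \<ge> exp ((s0 + \<delta>) / \<epsilon>) \<and> r > 0 \<and> \<bar>r - t\<bar> < t powr lam \<and>
                 q \<epsilon> (t, r *\<^sub>R \<omega>0) > q0 \<longrightarrow>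
             norm (d_t upper_half (u \<epsilon>) (t, r *\<^sub>R \<omega>0) - d_r upper_half (u \<epsilon>) (t, r *\<^sub>R \<omega>0))
               \<ge> c * M * \<epsilon> * t powr (-1 - C\<kappa> * \<epsilon>) * jb (r - t) powr (- \<kappa>)) \<and>
          \<not> compact (data_support (u \<epsilon>))))"
        unfolding V_def[symmetric]
        by (rule profile_lower_bound[where p = "-1/2" and S = "\<lambda>\<epsilon>. data_support (u \<epsilon>)",
              OF K C \<epsilon>1(1) \<delta>(1) \<kappa>0 _ l0[OF \<kappa>] q' app(2)[folded V_def] speed' cont(2)])
          (use \<kappa> in auto)
    qed
  qed
qed

end
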